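(* Let $m\ge1$ and let subspaces $\widetilde{\ker}\sigma_i\subset\ker\sigma_i$ be chosen as in the context. The graded vector space $B(V)=\bigoplus_{n\ge0}\ker\sigma_n$, with multiplication given by $\otimes$, is a free (associative, unital) algebra freely generated by the union of chosen bases of $\widetilde{\ker}\sigma_i$ for $2\le i\le m+1$. Moreover, with $b_i=\dim\widetilde{\ker}\sigma_i$, one has $$1-\sum_{i=2}^{m+1}b_iq^i=(1-mq)(1+q)^m.$$
   Context: Let $\mathbb{K}=\mathbb{C}(y)$, and let $V=V_m$ be the $\mathbb{K}$-vector space with basis $v_1,\dots,v_m$; tensor products are over $\mathbb{K}$. The Yang-Baxter operator $R=R_m:V\otimes V\to V\otimes V$ is the linear map with $R(v_i\otimes v_j)=(1-y^2)v_i\otimes v_j+y^2v_j\otimes v_i$ and $R(v_j\otimes v_i)=v_i\otimes v_j$ for $1\le i<j\le m$, and $R(v_i\otimes v_i)=v_i\otimes v_i$. For $n\ge1$ let $d_1^n=\mathrm{id}_{V^{\otimes n}}$ and, for $2\le k\le n$, $d_k^n=(R\otimes\mathrm{id}_{V^{\otimes n-2}})\circ(\mathrm{id}_V\otimes R\otimes\mathrm{id}_{V^{\otimes n-3}})\circ\cdots\circ(\mathrm{id}_{V^{\otimes k-2}}\otimes R\otimes\mathrm{id}_{V^{\otimes n-k}})$ (the rightmost map is applied first). Let $\sigma_n=\sum_{k=1}^n(-1)^{k-1}d_k^n:V^{\otimes n}\to V^{\otimes n}$, and put $\ker\sigma_0=\mathbb{K}=V^{\otimes0}$. One has $\ker\sigma_s\otimes\ker\sigma_t\subset\ker\sigma_{s+t}$,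 so $B(V)=\bigoplus_{n\ge0}\ker\sigma_n$ is a graded subalgebra of the tensor algebra $T(V)$. Inductively, $\widetilde{\ker}\sigma_1=\ker\sigma_1=\{0\}$, and for each $n\ge2$ a subspace $\widetilde{\ker}\sigma_n$ of $\ker\sigma_n$ is chosen so that $(\ker\sigma_{n-1}\otimes\widetilde{\ker}\sigma_1+\cdots+\ker\sigma_1\otimes\widetilde{\ker}\sigma_{n-1})\oplus\widetilde{\ker}\sigma_n=\ker\sigma_n$. *)

theory Defs
  imports
    "HOL-Computational_Algebra.Computational_Algebra"
    "HOL-Library.Poly_Mapping"
begin

section \<open>Vector spaces and algebras of finitely supported functions\<close>

definition smul :: "'k::field \<Rightarrow> ('a \<Rightarrow>\<^sub>0 'k) \<Rightarrow> ('a \<Rightarrow>\<^sub>0 'k)"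
  where "smul c p = Poly_Mapping.map (\<lambda>x. c * x) p"

lemma lookup_smul [simp]: "Poly_Mapping.lookup (smul c p) w = c * Poly_Mapping.lookup p w"
  by (simp add: smul_def Poly_Mapping.map.rep_eq when_def)

global_interpretation pm: vector_space "smul :: 'k::field \<Rightarrow> ('a \<Rightarrow>\<^sub>0 'k) \<Rightarrow> _"
  by unfold_locales
     (auto intro!: poly_mapping_eqI simp: lookup_add algebra_simps)

definition is_basis :: "('a \<Rightarrow>\<^sub>0 'k::field) set \<Rightarrow> ('a \<Rightarrow>\<^sub>0 'k) set \<Rightarrow> bool"
  where "is_basis B U \<longleftrightarrow> pm.independent B \<and> pm.span B = U"

definition is_direct_sum ::
    "('a \<Rightarrow>\<^sub>0 'k::field) set \<Rightarrow> ('a \<Rightarrow>\<^sub>0 'k) set \<Rightarrow> ('a \<Rightarrow>\<^sub>0 'k) set \<Rightarrow> bool"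
  where "is_direct_sum U U' S \<longleftrightarrow>
    pm.subspace U \<and> pm.subspace U' \<and> U \<inter> U' = {0} \<and> {u + u' |u u'. u \<in> U \<and> u' \<in> U'} = S"

definition lin_ext :: "('b \<Rightarrow> ('a \<Rightarrow>\<^sub>0 'k::field)) \<Rightarrow> ('b \<Rightarrow>\<^sub>0 'k) \<Rightarrow> ('a \<Rightarrow>\<^sub>0 'k)"
  where "lin_ext f p = (\<Sum>w\<in>Poly_Mapping.keys p. smul (Poly_Mapping.lookup p w) (f w))"

text \<open>
  Lists form the free monoid, so that the convolution product of \<^theory>\<open>HOL-Library.Poly_Mapping\<close>
  makes the finitely supported functions on lists over \<open>X\<close> into the free unital associative
  algebra on \<open>X\<close>.
\<close>

instantiation list :: (type) monoid_add
begin
definition zero_list :: "'a list" where "zero_list = []"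
definition plus_list :: "'a list \<Rightarrow> 'a list \<Rightarrow> 'a list" where "plus_list = append"
instance by standard (simp_all add: zero_list_def plus_list_def)
end

definition is_subalgebra :: "('a::monoid_add \<Rightarrow>\<^sub>0 'k::field) set \<Rightarrow> bool"
  where "is_subalgebra A \<longleftrightarrow> pm.subspace A \<and> 1 \<in> A \<and> (\<forall>p\<in>A. \<forall>q\<in>A. p * q \<in> A)"

definition free_algebra :: "'b set \<Rightarrow> ('b list \<Rightarrow>\<^sub>0 'k::field) set"
  where "free_algebra X = {p. \<forall>w\<in>Poly_Mapping.keys p. set w \<subseteq> X}"

text \<open>
  The map \<open>lin_ext prod_list\<close> sends a formal word in elements of \<open>X\<close> to the product of its
  letters; it is the unique homomorphism of unital algebras from the free algebra on \<open>X\<close> that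
  fixes the generators. Free generation means that it is an isomorphism onto \<open>A\<close>.
\<close>

definition freely_generated :: "('a::monoid_add \<Rightarrow>\<^sub>0 'k::field) set \<Rightarrow> ('a \<Rightarrow>\<^sub>0 'k) set \<Rightarrow> bool"
  where "freely_generated A X \<longleftrightarrow>
    is_subalgebra A \<and> X \<subseteq> A \<and>
    bij_betw (lin_ext prod_list) (free_algebra X) A"


section \<open>The tensor algebra and the Yang--Baxter operator\<close>

type_synonym K = "complex poly fract"

definition y_K :: K
  where "y_K = Fract [:0, 1:] 1"

text \<open>
  The word \<open>[i\<^sub>1, \<dots>, i\<^sub>n]\<close> stands for the basis vector \<open>v\<close> with indices \<open>i\<^sub>1, \<dots>, i\<^sub>n\<close>, i.e.
  for the tensor product of the corresponding basis vectors of \<open>V\<close>. The algebra \<open>T(V\<^sub>m)\<close> consists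
  of the elements below supported on words over \<open>{1..m}\<close>, and \<open>\<otimes>\<close> is the product of the ring.
\<close>

type_synonym tens = "nat list \<Rightarrow>\<^sub>0 K"

definition word_vec :: "nat list \<Rightarrow> tens"
  where "word_vec w = Poly_Mapping.single w 1"

definition Vpow :: "nat \<Rightarrow> nat \<Rightarrow> tens set"
  where "Vpow m n = {p. \<forall>w\<in>Poly_Mapping.keys p. length w = n \<and> set w \<subseteq> {1..m}}"

definition R_basis :: "nat \<Rightarrow> nat \<Rightarrow> tens"
  where "R_basis i j =
    (if i < j then smul (1 - y_K\<^sup>2) (word_vec [i, j]) + smul (y_K\<^sup>2) (word_vec [j, i])
     else word_vec [j, i])"

text \<open>
  \<open>R_at i\<close> is \<open>id \<otimes> R \<otimes> id\<close> with \<open>R\<close> acting on the tensor factors \<open>i + 1\<close> and \<open>i + 2\<close>. It is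
  meaningful on \<open>Vpow m n\<close> for \<open>i + 2 \<le> n\<close> and is only used there. The formula does not mention
  \<open>n\<close>, as the last identity takes up all remaining factors; hence neither does \<open>d_map k\<close>, which on
  \<open>Vpow m n\<close> with \<open>1 \<le> k \<le> n\<close> is the operator \<open>d\<^sub>k\<^sup>n\<close>.
\<close>

definition R_at :: "nat \<Rightarrow> tens \<Rightarrow> tens"
  where "R_at i =
    lin_ext (\<lambda>w. word_vec (take i w) * R_basis (w ! i) (w ! (i + 1)) * word_vec (drop (i + 2) w))"

definition d_map :: "nat \<Rightarrow> tens \<Rightarrow> tens"
  where "d_map k = foldr (\<circ>) (map R_at [0..<k - 1]) id"

definition \<sigma> :: "nat \<Rightarrow> tens \<Rightarrow> tens"
  where "\<sigma> n p = (\<Sum>k = 1..n. smul ((-1) ^ (k - 1)) (d_map k p))"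

text \<open>For \<open>n = 0\<close> the sum is empty, so \<open>ker\<sigma> m 0 = Vpow m 0\<close> is the line of scalars, as required.\<close>

definition ker\<sigma> :: "nat \<Rightarrow> nat \<Rightarrow> tens set"
  where "ker\<sigma> m n = {p \<in> Vpow m n. \<sigma> n p = 0}"

definition BV :: "nat \<Rightarrow> tens set"
  where "BV m = pm.span (\<Union>n. ker\<sigma> m n)"


section \<open>The chosen complements\<close>

definition tensor_sub :: "tens set \<Rightarrow> tens set \<Rightarrow> tens set"
  where "tensor_sub U U' = pm.span {u * u' |u u'. u \<in> U \<and> u' \<in> U'}"

definition is_choice :: "nat \<Rightarrow> (nat \<Rightarrow> tens set) \<Rightarrow> bool"
  where "is_choice m W \<longleftrightarrow>
    W 1 = {0} \<and>
    (\<forall>n\<ge>2. pm.subspace (W n) \<and> W n \<subseteq> ker\<sigma> m n \<and>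
      is_direct_sum (pm.span (\<Union>i\<in>{1..n - 1}. tensor_sub (ker\<sigma> m (n - i)) (W i))) (W n)
        (ker\<sigma> m n))"

end

theory Submission
  imports Defs
begin

text \<open>
  The operators \<open>\<sigma>\<close> satisfy the twisted Leibniz rule
  \<open>\<sigma> (x \<otimes> y) = \<sigma> x \<otimes> y \<plusminus> d (x \<otimes> \<sigma> y)\<close>, where \<open>d\<close> moves the first factor of \<open>\<sigma> y\<close> to the front.
  If generators were left dependent over the tensor algebra, cancelling a prefix (weak algorithm)
  would write an element of some chosen complement as \<open>\<Sum> c\<^sub>i \<otimes> w\<^sub>i\<close> with \<open>w\<^sub>i\<close> independent generators of lower
  degree; applying \<open>\<sigma>\<close> gives \<open>\<Sum> \<sigma> c\<^sub>i \<otimes> w\<^sub>i = 0\<close>, so all \<open>c\<^sub>i\<close> are in the kernels, against the choice of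
  the complement. Hence the algebra is free. For the Hilbert series, the braid relation shows that
  braided commutators with letters preserve the kernels, and together with the quadratic
  relations this makes \<open>T(V)\<close> a free left module over \<open>B(V)\<close> on the strictly decreasing words: they
  generate, and they are independent since \<open>\<sigma>\<close> acts on them by deleting letters with signs. So
  the Hilbert series of \<open>B(V)\<close> is \<open>1 / ((1 - m q) (1 + q)\<^sup>m)\<close>.
\<close>

subsection \<open>Linear maps\<close>

abbreviation lin :: "(('a \<Rightarrow>\<^sub>0 'k::field) \<Rightarrow> ('b \<Rightarrow>\<^sub>0 'k)) \<Rightarrow> bool"
  where "lin \<equiv> Vector_Spaces.linear smul smul"

lemma linI:
  "(\<And>x y. f (x + y) = f x + f y) \<Longrightarrow> (\<And>c x. f (smul c x) = smul c (f x)) \<Longrightarrow> lin f"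
  by (simp add: Vector_Spaces.linear_iff pm.vector_space_axioms)

lemma linD:
  assumes "lin f"
  shows lin_add: "f (x + y) = f x + f y"
    and lin_smul: "f (smul c x) = smul c (f x)"
  using assms by (auto simp: Vector_Spaces.linear_iff)

lemma lin_zero: "lin f \<Longrightarrow> f 0 = 0"
  by (metis linD(2) pm.scale_zero_left)

lemma lin_minus: "lin f \<Longrightarrow> f (x - y) = f x - f y"
  by (metis add_diff_cancel_right' diff_add_cancel linD(1))

lemma lin_sum: "lin f \<Longrightarrow> f (sum g A) = (\<Sum>i\<in>A. f (g i))"
  by (induction A rule: infinite_finite_induct) (simp_all add: lin_zero lin_add)

lemma lin_eq_on_span:
  assumes "lin f" "lin g" "\<And>x. x \<in> S \<Longrightarrow> f x = g x" "x \<in> pm.span S"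
  shows "f x = g x"
  using assms(4)
  by (induction rule: pm.span_induct_alt) (simp_all add: lin_zero linD assms)

lemma lin_span_subset:
  assumes "lin f" "pm.subspace U" "\<And>x. x \<in> S \<Longrightarrow> f x \<in> U" "x \<in> pm.span S"
  shows "f x \<in> U"
  using assms(4)
  by (induction rule: pm.span_induct_alt)
    (auto simp: lin_zero linD assms
      intro!: pm.subspace_0[OF assms(2)] pm.subspace_add[OF assms(2)] pm.subspace_scale[OF assms(2)])

lemma lin_id: "lin id" and lin_comp: "lin f \<Longrightarrow> lin g \<Longrightarrow> lin (\<lambda>x. f (g x))"
  by (auto intro!: linI simp: linD)

lemma lin_smul_comp: "lin f \<Longrightarrow> lin (\<lambda>x. smul c (f x))"
  by (auto intro!: linI simp: linD pm.scale_right_distrib mult.commute)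

lemma lin_sum_comp: "(\<And>i. lin (f i)) \<Longrightarrow> lin (\<lambda>x. \<Sum>i\<in>A. f i x)"
  by (rule linI) (simp_all add: linD sum.distrib pm.scale_sum_right)

lemma smul_mult_left: "smul c p * q = smul c (p * q)"
  for p q :: "'a::monoid_add \<Rightarrow>\<^sub>0 'k::field"
  by (simp add: smul_def mult_map_scale_conv_mult mult.assoc)

lemma poly_mapping_expand:
  assumes "finite A" "Poly_Mapping.keys p \<subseteq> A"
  shows "p = (\<Sum>w\<in>A. smul (Poly_Mapping.lookup p w) (Poly_Mapping.single w 1))"
proof (rule poly_mapping_eqI)
  fix k
  have "(\<Sum>w\<in>A. Poly_Mapping.lookup p w * (1 when w = k))
      = (\<Sum>w\<in>A. if w = k then Poly_Mapping.lookup p w else 0)"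
    by (intro sum.cong) (auto simp: when_def)
  then show "Poly_Mapping.lookup p k = Poly_Mapping.lookup
      (\<Sum>w\<in>A. smul (Poly_Mapping.lookup p w) (Poly_Mapping.single w 1)) k"
    using assms by (auto simp: lookup_sum lookup_single in_keys_iff)
qed

lemma span_single:
  "pm.span ((\<lambda>w. Poly_Mapping.single w (1::'k::field)) ` S) = {p. Poly_Mapping.keys p \<subseteq> S}"
  (is "?L = ?R")
proof
  have "pm.subspace ?R"
    by (auto simp: pm.subspace_def in_keys_iff lookup_add subset_eq)
  then show "?L \<subseteq> ?R"
    by (rule pm.span_minimal[rotated]) auto
  show "?R \<subseteq> ?L"
  proof
    fix p :: "'a \<Rightarrow>\<^sub>0 'k"
    assume "p \<in> ?R"
    then have "(\<Sum>w\<in>Poly_Mapping.keys p. smul (Poly_Mapping.lookup p w) (Poly_Mapping.single w 1)) \<in> ?L"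
      by (intro pm.span_sum pm.span_scale pm.span_base) auto
    then show "p \<in> ?L"
      using poly_mapping_expand[of "Poly_Mapping.keys p" p] by simp
  qed
qed

lemma poly_mapping_span_UNIV: "p \<in> pm.span (range (\<lambda>w. Poly_Mapping.single w (1::'k::field)))"
  by (simp add: span_single)

lemma lin_eqI:
  assumes "lin f" "lin g" "\<And>w. f (Poly_Mapping.single w 1) = g (Poly_Mapping.single w 1)"
  shows "f p = g p"
  by (rule lin_eq_on_span[OF assms(1,2) _ poly_mapping_span_UNIV]) (auto simp: assms)

lemma smul_mult_right: "p * smul c q = smul c (p * q)"
  for p q :: "'a::monoid_add \<Rightarrow>\<^sub>0 'k::field"
proof -
  \<comment> \<open>Scaling is right multiplication by a constant, so the claim becomes
    associativity.\<close>
  have *: "smul c r = r * Poly_Mapping.single 0 c" for r :: "'a \<Rightarrow>\<^sub>0 'k"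
    by (rule lin_eqI[where f = "smul c" and g = "\<lambda>r. r * Poly_Mapping.single 0 c"])
      (auto intro!: linI poly_mapping_eqI simp: distrib_right smul_mult_left
        pm.scale_right_distrib mult.commute mult_single lookup_single when_def)
  show ?thesis by (simp add: * mult.assoc)
qed

lemma lin_mult_left: "lin (\<lambda>q. p * q)" and lin_mult_right: "lin (\<lambda>q. q * p)"
  for p :: "'a::monoid_add \<Rightarrow>\<^sub>0 'k::field"
  by (auto intro!: linI simp: distrib_left distrib_right smul_mult_left smul_mult_right)

lemma lin_ext_superset:
  assumes "finite A" "Poly_Mapping.keys p \<subseteq> A"
  shows "lin_ext f p = (\<Sum>w\<in>A. smul (Poly_Mapping.lookup p w) (f w))"
  unfolding lin_ext_def
  by (rule sum.mono_neutral_left) (use assms in \<open>auto simp: in_keys_iff\<close>)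

lemma lin_lin_ext: "lin (lin_ext f)"
  for f :: "'b \<Rightarrow> ('a \<Rightarrow>\<^sub>0 'k::field)"
proof (rule linI)
  fix p q :: "'b \<Rightarrow>\<^sub>0 'k" and c :: 'k
  let ?A = "Poly_Mapping.keys p \<union> Poly_Mapping.keys q"
  have "lin_ext f (p + q) = (\<Sum>w\<in>?A. smul (Poly_Mapping.lookup (p + q) w) (f w))"
    by (intro lin_ext_superset keys_add) simp
  also have "\<dots> = lin_ext f p + lin_ext f q"
    by (simp add: lin_ext_superset[of ?A] lookup_add pm.scale_left_distrib sum.distrib)
  finally show "lin_ext f (p + q) = lin_ext f p + lin_ext f q" .
  have "lin_ext f (smul c p) = (\<Sum>w\<in>Poly_Mapping.keys p. smul (Poly_Mapping.lookup (smul c p) w) (f w))"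
    by (intro lin_ext_superset) (auto simp: in_keys_iff)
  then show "lin_ext f (smul c p) = smul c (lin_ext f p)"
    by (simp add: lin_ext_def pm.scale_sum_right)
qed

lemma lin_ext_single: "lin_ext f (Poly_Mapping.single w 1) = f w"
  by (simp add: lin_ext_def)

lemma independent_sum_zero:
  assumes "finite B" "pm.independent B" "(\<Sum>b\<in>B. smul (c b) b) = 0" "b \<in> B"
  shows "c b = 0"
  using assms pm.independentD by blast

text \<open>Joint injectivity makes the sum of the images direct, so the images of the bases
  together form a basis. Both dimension counts for the kernels use this, with right multiplications
  as the maps.\<close>

lemma dim_joint_injective:
  assumes J: "finite J"
    and f: "\<And>j. j \<in> J \<Longrightarrow> lin (f j)"
    and A: "\<And>j. j \<in> J \<Longrightarrow> finite (A j) \<and> pm.independent (A j)"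
    and inj: "\<And>a. (\<And>j. j \<in> J \<Longrightarrow> a j \<in> pm.span (A j)) \<Longrightarrow> (\<Sum>j\<in>J. f j (a j)) = 0
      \<Longrightarrow> (\<And>j. j \<in> J \<Longrightarrow> a j = 0)"
    and U: "U = pm.span (\<Union>j\<in>J. f j ` pm.span (A j))"
  shows "pm.dim U = (\<Sum>j\<in>J. card (A j))"
proof -
  let ?g = "\<lambda>(j, b). f j b"
  let ?S = "Sigma J A"
  have fin: "finite ?S" using J A by auto
  have g: "inj_on ?g ?S"
  proof (rule inj_onI, clarify)
    fix j b k b'
    assume H: "j \<in> J" "b \<in> A j" "k \<in> J" "b' \<in> A k" "f j b = f k b'"
    \<comment> \<open>The coincidence of \<open>f j b\<close> and \<open>f k b'\<close> as a
      relation between vectors; if \<open>j \<noteq> k\<close>, its vanishing at \<open>j\<close>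
      would force \<open>b = 0\<close>.\<close>
    define a where "a i = (if i = j then b else 0) - (if i = k then b' else 0)" for i
    have "a i \<in> pm.span (A i)" for i
      unfolding a_def using H by (intro pm.span_diff) (auto intro: pm.span_base pm.span_zero)
    moreover have "(\<Sum>i\<in>J. f i (a i)) = 0"
    proof -
      have "(\<Sum>i\<in>J. f i (a i)) = (\<Sum>i\<in>J. (if i = j then f i b else 0) - (if i = k then f i b' else 0))"
        by (intro sum.cong refl) (auto simp: a_def lin_minus lin_zero f)
      also have "\<dots> = 0" using H J by (simp add: sum_subtractf)
      finally show ?thesis .
    qed
    ultimately have 0: "a i = 0" if "i \<in> J" for i using inj that by blast
    have "b \<noteq> 0" using A H pm.dependent_zero by metis
    then show "j = k \<and> b = b'" using 0[of j] H by (auto simp: a_def split: if_splits)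
  qed
  have "pm.independent (?g ` ?S)"
  proof (rule pm.independent_if_scalars_zero)
    show "finite (?g ` ?S)" using fin by simp
    fix c x
    assume c: "(\<Sum>x\<in>?g ` ?S. smul (c x) x) = 0" and x: "x \<in> ?g ` ?S"
    define a where "a j = (\<Sum>b\<in>A j. smul (c (f j b)) b)" for j
    have "(\<Sum>j\<in>J. f j (a j)) = (\<Sum>j\<in>J. \<Sum>b\<in>A j. smul (c (f j b)) (f j b))"
      by (intro sum.cong refl) (simp add: a_def lin_sum lin_smul f)
    also have "\<dots> = (\<Sum>p\<in>?S. smul (c (?g p)) (?g p))"
      using J A by (subst sum.Sigma) (auto simp: case_prod_unfold)
    also have "\<dots> = 0" using c g by (simp add: sum.reindex)
    finally have "(\<Sum>j\<in>J. f j (a j)) = 0" .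
    moreover have "a j \<in> pm.span (A j)" for j
      unfolding a_def by (intro pm.span_sum pm.span_scale pm.span_base)
    ultimately have 0: "a i = 0" if "i \<in> J" for i using inj that by blast
    obtain j b where jb: "j \<in> J" "b \<in> A j" "x = f j b" using x by auto
    show "c x = 0"
      using independent_sum_zero[of "A j" "\<lambda>b. c (f j b)" b] 0[of j] jb A by (simp add: a_def)
  qed
  moreover have "pm.span (?g ` ?S) = pm.span U"
  proof (intro antisym)
    show "pm.span (?g ` ?S) \<subseteq> pm.span U"
      unfolding U by (intro pm.span_mono) (auto intro!: pm.span_base)
    have "f j a \<in> pm.span (?g ` ?S)" if "j \<in> J" "a \<in> pm.span (A j)" for j a
      by (rule lin_span_subset[OF f pm.subspace_span _ that(2)])
        (use that in \<open>auto intro!: pm.span_base image_eqI[where x = "(j, _)"]\<close>)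
    then show "pm.span U \<subseteq> pm.span (?g ` ?S)"
      unfolding U pm.span_span by (intro pm.span_minimal) auto
  qed
  ultimately have "pm.dim U = card (?g ` ?S)"
    using pm.dim_eq_card by blast
  also have "\<dots> = card ?S" using g by (rule card_image)
  finally show ?thesis using J A by simp
qed

section \<open>Words and the homogeneous parts of the tensor algebra\<close>

lemma word_vec_append: "word_vec (u @ w) = word_vec u * word_vec w"
  by (simp add: word_vec_def mult_single plus_list_def)

lemma word_vec_Nil [simp]: "word_vec [] = 1"
  by (simp add: word_vec_def flip: zero_list_def)

lemma word_vec_Cons: "word_vec (i # w) = word_vec [i] * word_vec w"
  using word_vec_append[of "[i]" w] by simp

lemma tens_eqI:
  assumes "lin f" "lin g" "\<And>w. f (word_vec w) = g (word_vec w)"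
  shows "f p = g p"
  using assms lin_eqI unfolding word_vec_def by metis

definition words :: "nat \<Rightarrow> nat \<Rightarrow> nat list set"
  where "words m n = {w. length w = n \<and> set w \<subseteq> {1..m}}"

lemma finite_words: "finite (words m n)"
  using finite_lists_length_eq[of "{1..m}" n] by (simp add: words_def conj_commute)

lemma card_words: "card (words m n) = m ^ n"
  using card_lists_length_eq[of "{1..m}" n] by (simp add: words_def conj_commute)

lemma Vpow_eq_span: "Vpow m n = pm.span (word_vec ` words m n)"
  unfolding word_vec_def[abs_def] span_single by (auto simp: Vpow_def words_def)

lemma subspace_Vpow: "pm.subspace (Vpow m n)"
  by (simp add: Vpow_eq_span)

lemmas Vpow_closed [intro] =
  pm.subspace_0[OF subspace_Vpow] pm.subspace_add[OF subspace_Vpow]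
  pm.subspace_diff[OF subspace_Vpow] pm.subspace_scale[OF subspace_Vpow]
  pm.subspace_sum[OF subspace_Vpow]

lemma word_vec_in_Vpow [intro]: "w \<in> words m n \<Longrightarrow> word_vec w \<in> Vpow m n"
  by (simp add: Vpow_def word_vec_def words_def)

lemma Vpow_eqI:
  assumes "lin f" "lin g" "p \<in> Vpow m n"
    "\<And>w. length w = n \<Longrightarrow> set w \<subseteq> {1..m} \<Longrightarrow> f (word_vec w) = g (word_vec w)"
  shows "f p = g p"
  using assms(3) unfolding Vpow_eq_span
  by (rule lin_eq_on_span[OF assms(1,2), rotated]) (auto simp: words_def assms(4))

lemma Vpow_linI:
  assumes "lin f" "pm.subspace U" "p \<in> Vpow m n"
    "\<And>w. length w = n \<Longrightarrow> set w \<subseteq> {1..m} \<Longrightarrow> f (word_vec w) \<in> U"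
  shows "f p \<in> U"
  using assms(3) unfolding Vpow_eq_span
  by (rule lin_span_subset[OF assms(1,2), rotated]) (auto simp: words_def assms(4))

lemma Vpow_mult [intro]:
  assumes "x \<in> Vpow m a" "y \<in> Vpow m b"
  shows "x * y \<in> Vpow m (a + b)"
proof -
  have "word_vec u * y \<in> Vpow m (a + b)" if "length u = a" "set u \<subseteq> {1..m}" for u
    by (rule Vpow_linI[OF lin_mult_left subspace_Vpow assms(2)])
      (use that in \<open>auto simp: words_def simp flip: word_vec_append\<close>)
  then show ?thesis
    by (intro Vpow_linI[OF lin_mult_right subspace_Vpow assms(1)])
qed

lemma Vpow_0: "Vpow m 0 = range (\<lambda>c. smul c 1)"
proof -
  have "words m 0 = {[]}" by (auto simp: words_def)
  then show ?thesis by (simp add: Vpow_eq_span pm.span_singleton)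
qed

subsection \<open>Cancelling prefixes and suffixes\<close>

text \<open>Left division by \<open>u\<close>: words with prefix \<open>u\<close> lose it, all
  others go to zero.\<close>

definition lquot :: "nat list \<Rightarrow> tens \<Rightarrow> tens"
  where "lquot u = Poly_Mapping.map_key (\<lambda>w. u @ w)"

text \<open>The type of letters is left open because the same operation is applied later to words in
  the generators.\<close>

definition rquot :: "'a \<Rightarrow> ('a list \<Rightarrow>\<^sub>0 K) \<Rightarrow> ('a list \<Rightarrow>\<^sub>0 K)"
  where "rquot i = Poly_Mapping.map_key (\<lambda>w. w @ [i])"

lemma lookup_lquot: "Poly_Mapping.lookup (lquot u p) w = Poly_Mapping.lookup p (u @ w)"
  by (simp add: lquot_def Poly_Mapping.map_key.rep_eq inj_def)

lemma lookup_rquot: "Poly_Mapping.lookup (rquot i p) w = Poly_Mapping.lookup p (w @ [i])"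
  by (simp add: rquot_def Poly_Mapping.map_key.rep_eq inj_def)

lemma lin_lquot: "lin (lquot u)" and lin_rquot: "lin (rquot i)"
  by (auto intro!: linI poly_mapping_eqI simp: lookup_lquot lookup_rquot lookup_add)

lemma lquot_word_vec_same: "lquot u (word_vec (u @ w)) = word_vec w"
  by (auto intro!: poly_mapping_eqI simp: lookup_lquot word_vec_def lookup_single when_def)

lemma lquot_word_vec_other:
  "length u = length u' \<Longrightarrow> u \<noteq> u' \<Longrightarrow> lquot u (word_vec (u' @ w)) = 0"
  by (auto intro!: poly_mapping_eqI simp: lookup_lquot word_vec_def lookup_single when_def)

lemma rquot_word_vec: "rquot i (word_vec (w @ [j])) = (if i = j then word_vec w else 0)"
  by (auto intro!: poly_mapping_eqI simp: lookup_rquot word_vec_def lookup_single when_def)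

text \<open>The bound on \<open>length u\<close> keeps the cancellation inside the left
  factor.\<close>

lemma lquot_mult:
  assumes "p \<in> Vpow m n" "length u \<le> n"
  shows "lquot u (p * r) = lquot u p * r"
proof (rule Vpow_eqI[OF _ _ assms(1)])
  show "lin (\<lambda>p. lquot u (p * r))" by (rule lin_comp[OF lin_lquot lin_mult_right])
  show "lin (\<lambda>p. lquot u p * r)" by (rule lin_comp[OF lin_mult_right lin_lquot])
next
  fix w assume w: "length w = n" "set w \<subseteq> {1..m}"
  define u' w' where "u' = take (length u) w" and "w' = drop (length u) w"
  have w': "w = u' @ w'" "length u' = length u"
    using w assms by (auto simp: u'_def w'_def)
  have *: "lquot u (word_vec (w @ v)) = lquot u (word_vec w) * word_vec v" for v
    by (cases "u = u'")
      (simp_all add: w' lquot_word_vec_same lquot_word_vec_other word_vec_append[of w' v])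
  show "lquot u (word_vec w * r) = lquot u (word_vec w) * r"
    by (rule tens_eqI[OF lin_comp[OF lin_lquot lin_mult_left] lin_mult_left])
      (simp add: * flip: word_vec_append)
qed

lemma lquot_in_Vpow:
  assumes "p \<in> Vpow m (length u + n)"
  shows "lquot u p \<in> Vpow m n"
proof (rule Vpow_linI[OF lin_lquot subspace_Vpow assms])
  fix w assume w: "length w = length u + n" "set w \<subseteq> {1..m}"
  define u' w' where "u' = take (length u) w" and "w' = drop (length u) w"
  have w': "w = u' @ w'" "length u' = length u" "length w' = n" "set w' \<subseteq> {1..m}"
    using w set_drop_subset[of "length u" w] by (auto simp: u'_def w'_def)
  show "lquot u (word_vec w) \<in> Vpow m n"
    using w'(2-4) by (cases "u = u'") (auto simp: words_def w'(1) lquot_word_vec_same lquot_word_vec_other)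
qed

lemma rquot_in_Vpow:
  assumes "p \<in> Vpow m (Suc n)"
  shows "rquot i p \<in> Vpow m n"
proof (rule Vpow_linI[OF lin_rquot subspace_Vpow assms])
  fix w assume w: "length w = Suc n" "set w \<subseteq> {1..m}"
  then obtain w' j where "w = w' @ [j]" by (metis length_Suc_conv_rev)
  with w show "rquot i (word_vec w) \<in> Vpow m n" by (auto simp: rquot_word_vec words_def)
qed

lemma rquot_mult: "rquot i (p * word_vec [j]) = (if i = j then p else 0)"
  by (rule tens_eqI[OF lin_comp[OF lin_rquot lin_mult_right]])
    (auto intro!: linI simp: rquot_word_vec simp flip: word_vec_append)

lemma lquot_mult_left: "lquot [i] (word_vec [j] * p) = (if i = j then p else 0)"
  by (rule tens_eqI[OF lin_comp[OF lin_lquot lin_mult_left]])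
    (auto intro!: linI simp: lquot_word_vec_same[of "[_]", simplified]
      lquot_word_vec_other[of "[_]" "[_]", simplified] simp flip: word_vec_append)

lemma lquot_expand:
  assumes "p \<in> Vpow m (Suc n)"
  shows "(\<Sum>i\<in>{1..m}. word_vec [i] * lquot [i] p) = p"
proof (rule Vpow_eqI[OF lin_sum_comp[OF lin_comp[OF lin_mult_left lin_lquot]] _ assms])
  show "lin (\<lambda>p::tens. p)" by (rule linI) simp_all
  fix w :: "nat list" assume w: "length w = Suc n" "set w \<subseteq> {1..m}"
  then obtain j w' where w': "w = j # w'" by (cases w) auto
  have "(\<Sum>i\<in>{1..m}. word_vec [i] * lquot [i] (word_vec w))
      = (\<Sum>i\<in>{1..m}. if i = j then word_vec w else 0)"
    by (intro sum.cong refl) (simp add: w' word_vec_Cons[of j w'] lquot_mult_left)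
  then show "(\<Sum>i\<in>{1..m}. word_vec [i] * lquot [i] (word_vec w)) = word_vec w"
    using w w' by simp
qed

lemma rquot_expand:
  assumes "p \<in> Vpow m (Suc n)"
  shows "(\<Sum>i\<in>{1..m}. rquot i p * word_vec [i]) = p"
proof (rule Vpow_eqI[OF lin_sum_comp[OF lin_comp[OF lin_mult_right lin_rquot]] _ assms])
  show "lin (\<lambda>p::tens. p)" by (rule linI) simp_all
  fix w :: "nat list" assume w: "length w = Suc n" "set w \<subseteq> {1..m}"
  then obtain j w' where w': "w = w' @ [j]" by (metis length_Suc_conv_rev)
  have "(\<Sum>i\<in>{1..m}. rquot i (word_vec w) * word_vec [i])
      = (\<Sum>i\<in>{1..m}. if i = j then word_vec w else 0)"
    by (intro sum.cong refl) (simp add: w' word_vec_append rquot_mult)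
  then show "(\<Sum>i\<in>{1..m}. rquot i (word_vec w) * word_vec [i]) = word_vec w"
    using w w' by simp
qed

lemma sum_left_letters_zero:
  assumes "(\<Sum>i\<in>I. word_vec [i] * z i) = 0" "finite I" "i \<in> I"
  shows "z i = 0"
proof -
  have "0 = lquot [i] (\<Sum>i\<in>I. word_vec [i] * z i)"
    by (simp add: assms lin_zero[OF lin_lquot])
  also have "\<dots> = z i"
    using assms(2,3) by (simp add: lin_sum[OF lin_lquot] lquot_mult_left)
  finally show ?thesis by simp
qed

lemma sum_right_letters_zero:
  assumes "(\<Sum>i\<in>I. z i * word_vec [i]) = 0" "finite I" "i \<in> I"
  shows "z i = 0"
proof -
  have "0 = rquot i (\<Sum>i\<in>I. z i * word_vec [i])"
    by (simp add: assms lin_zero[OF lin_rquot])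
  also have "\<dots> = z i"
    using assms(2,3) by (simp add: lin_sum[OF lin_rquot] rquot_mult)
  finally show ?thesis by simp
qed

subsection \<open>The braiding\<close>

lemma y_K_nonzero: "y_K \<noteq> 0"
  by (simp add: y_K_def eq_fract Zero_fract_def)

lemma lin_R_at: "lin (R_at i)"
  unfolding R_at_def by (rule lin_lin_ext)

lemma R_at_word:
  assumes "length u = i"
  shows "R_at i (word_vec (u @ a # b # t)) =
    (if a < b then smul (1 - y_K\<^sup>2) (word_vec (u @ a # b # t)) + smul (y_K\<^sup>2) (word_vec (u @ b # a # t))
     else word_vec (u @ b # a # t))"
proof -
  let ?w = "u @ a # b # t"
  have "R_at i (word_vec ?w) =
      word_vec (take i ?w) * R_basis (?w ! i) (?w ! (i + 1)) * word_vec (drop (i + 2) ?w)"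
    by (simp add: R_at_def word_vec_def lin_ext_single)
  also have "\<dots> = word_vec u * R_basis a b * word_vec t"
    using assms by (simp add: nth_append)
  also have "\<dots> = (if a < b
     then smul (1 - y_K\<^sup>2) (word_vec (u @ a # b # t)) + smul (y_K\<^sup>2) (word_vec (u @ b # a # t))
     else word_vec (u @ b # a # t))"
    by (simp add: R_basis_def distrib_left distrib_right smul_mult_left smul_mult_right
        flip: word_vec_append)
  finally show ?thesis .
qed

lemma word_split2:
  assumes "i + 2 \<le> length w"
  obtains u a b t where "w = u @ a # b # t" "length u = i"
proof -
  have "w = take i w @ w ! i # w ! Suc i # drop (Suc (Suc i)) w"
    using assms by (simp add: Cons_nth_drop_Suc)
  moreover have "length (take i w) = i" using assms by simp
  ultimately show ?thesis using that by blast
qed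

lemma R_at_in_Vpow [intro]:
  assumes "x \<in> Vpow m n" "i + 2 \<le> n"
  shows "R_at i x \<in> Vpow m n"
proof (rule Vpow_linI[OF lin_R_at subspace_Vpow assms(1)])
  fix w assume w: "length w = n" "set w \<subseteq> {1..m}"
  with assms(2) obtain u a b t where "w = u @ a # b # t" "length u = i"
    by (metis word_split2)
  with w show "R_at i (word_vec w) \<in> Vpow m n"
    by (auto simp: R_at_word words_def intro!: Vpow_closed word_vec_in_Vpow)
qed

lemma R_at_mult_left:
  assumes "x \<in> Vpow m n" "i + 2 \<le> n"
  shows "R_at i (x * y) = R_at i x * y"
proof (rule Vpow_eqI[OF lin_comp[OF lin_R_at lin_mult_right] lin_comp[OF lin_mult_right lin_R_at] assms(1)])
  fix w assume w: "length w = n" "set w \<subseteq> {1..m}"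
  with assms(2) obtain u a b t where uv: "w = u @ a # b # t" "length u = i"
    by (metis word_split2)
  show "R_at i (word_vec w * y) = R_at i (word_vec w) * y"
    by (rule tens_eqI[OF lin_comp[OF lin_R_at lin_mult_left] lin_mult_left])
      (simp add: uv R_at_word smul_mult_left distrib_right flip: word_vec_append)
qed

text \<open>The factor \<open>y\<close> is arbitrary, because position \<open>n + j\<close> of
  \<open>w @ v\<close> is position \<open>j\<close> of \<open>v\<close> even out of range.
  \<open>D_mult_right\<close> inherits this.\<close>

lemma R_at_mult_right:
  assumes "x \<in> Vpow m n"
  shows "R_at (n + i) (x * y) = x * R_at i y"
proof (rule Vpow_eqI[OF lin_comp[OF lin_R_at lin_mult_right] lin_mult_right assms(1)])
  fix w assume w: "length w = n" "set w \<subseteq> {1..m}"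
  have drop: "drop (n + j) (w @ v) = drop j v" for j v using w by simp
  show "R_at (n + i) (word_vec w * y) = word_vec w * R_at i y"
  proof (rule tens_eqI[OF lin_comp[OF lin_R_at lin_mult_left] lin_comp[OF lin_mult_left lin_R_at]])
    fix v
    have nth: "(w @ v) ! (n + j) = v ! j" for j
      using w nth_append_length_plus[of w v j] by simp
    have R: "R_at j (word_vec t)
        = word_vec (take j t) * R_basis (t ! j) (t ! (j + 1)) * word_vec (drop (j + 2) t)" for j t
      by (simp add: R_at_def word_vec_def[of t] lin_ext_single)
    have "R_at (n + i) (word_vec (w @ v)) = word_vec (w @ take i v) * R_basis (v ! i) (v ! (i + 1))
        * word_vec (drop (i + 2) v)"
      using w nth[of i] nth[of "i + 1"] drop[of "i + 2"] by (simp add: R add.assoc)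
    then show "R_at (n + i) (word_vec w * word_vec v) = word_vec w * R_at i (word_vec v)"
      by (simp add: R mult.assoc word_vec_append)
  qed
qed

text \<open>This is (R - 1)(R + y^2) = 0. As y is nonzero, it makes R invertible with an explicit
  inverse.\<close>

lemma R_at_Hecke:
  assumes "x \<in> Vpow m n" "i + 2 \<le> n"
  shows "R_at i (R_at i x) = smul (1 - y_K\<^sup>2) (R_at i x) + smul (y_K\<^sup>2) x"
proof (rule Vpow_eqI[OF lin_comp[OF lin_R_at lin_R_at] _ assms(1)])
  show "lin (\<lambda>x. smul (1 - y_K\<^sup>2) (R_at i x) + smul (y_K\<^sup>2) x)"
    by (rule linI) (simp_all add: linD[OF lin_R_at] pm.scale_right_distrib mult.commute)
  fix w assume w: "length w = n" "set w \<subseteq> {1..m}"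
  with assms(2) obtain u a b t where "w = u @ a # b # t" "length u = i"
    by (metis word_split2)
  then show "R_at i (R_at i (word_vec w)) = smul (1 - y_K\<^sup>2) (R_at i (word_vec w)) + smul (y_K\<^sup>2) (word_vec w)"
    by (cases a b rule: linorder_cases)
      (simp_all add: R_at_word linD[OF lin_R_at], auto intro!: poly_mapping_eqI simp: lookup_add algebra_simps)
qed

lemma R_at_inj:
  assumes "x \<in> Vpow m n" "i + 2 \<le> n" "R_at i x = 0"
  shows "x = 0"
  using R_at_Hecke[OF assms(1,2)] assms(3) y_K_nonzero by (simp add: lin_zero[OF lin_R_at])

lemma R_at_surj:
  assumes "z \<in> Vpow m n" "i + 2 \<le> n"
  shows "\<exists>x\<in>Vpow m n. R_at i x = z"
proof
  \<comment> \<open>The inverse of R read off from the quadratic relation.\<close>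
  let ?x = "smul (inverse (y_K\<^sup>2)) (R_at i z - smul (1 - y_K\<^sup>2) z)"
  show "?x \<in> Vpow m n" using assms by (intro Vpow_closed R_at_in_Vpow)
  show "R_at i ?x = z"
    using y_K_nonzero by (simp add: linD[OF lin_R_at] lin_minus[OF lin_R_at] R_at_Hecke[OF assms])
qed

text \<open>The Yang-Baxter equation. R depends only on the relative order of two letters, so
  comparing three letters pairwise leaves finitely many identities to check.\<close>

lemma R_at_braid:
  assumes "x \<in> Vpow m n" "i + 3 \<le> n"
  shows "R_at i (R_at (Suc i) (R_at i x)) = R_at (Suc i) (R_at i (R_at (Suc i) x))"
proof (rule Vpow_eqI[OF _ _ assms(1)])
  show "lin (\<lambda>x. R_at i (R_at (Suc i) (R_at i x)))" "lin (\<lambda>x. R_at (Suc i) (R_at i (R_at (Suc i) x)))"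
    by (intro lin_comp[OF lin_R_at] lin_R_at)+
  fix w assume w: "length w = n" "set w \<subseteq> {1..m}"
  with assms(2) have "i + 2 \<le> length w" by simp
  then obtain u a b t' where u: "w = u @ a # b # t'" "length u = i"
    by (metis word_split2)
  with w assms(2) obtain c t where t: "t' = c # t" by (cases t') auto
  have R1: "R_at (Suc i) (word_vec (u @ a # b # c # t)) =
    (if b < c then smul (1 - y_K\<^sup>2) (word_vec (u @ a # b # c # t))
        + smul (y_K\<^sup>2) (word_vec (u @ a # c # b # t))
     else word_vec (u @ a # c # b # t))" for a b c
    using R_at_word[of "u @ [a]" "Suc i" b c t] u by simp
  define q where "q = y_K\<^sup>2"
  note simps = R1[folded q_def] R_at_word[folded q_def] u(2) linD[OF lin_R_at]
  have "R_at i (R_at (Suc i) (R_at i (word_vec (u @ a # b # c # t))))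
      = R_at (Suc i) (R_at i (R_at (Suc i) (word_vec (u @ a # b # c # t))))"
    by (cases a b rule: linorder_cases; cases b c rule: linorder_cases; cases a c rule: linorder_cases)
      (simp_all add: simps, auto intro!: poly_mapping_eqI simp: lookup_add algebra_simps)
  then show "R_at i (R_at (Suc i) (R_at i (word_vec w))) = R_at (Suc i) (R_at i (R_at (Suc i) (word_vec w)))"
    by (simp add: u t)
qed

text \<open>Cutting the word at position \<open>j\<close> puts the two operators into different
  factors.\<close>

lemma R_at_commute:
  assumes "x \<in> Vpow m n" "i + 2 \<le> j" "j + 2 \<le> n"
  shows "R_at i (R_at j x) = R_at j (R_at i x)"
proof (rule Vpow_eqI[OF lin_comp[OF lin_R_at lin_R_at] lin_comp[OF lin_R_at lin_R_at] assms(1)])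
  fix w assume w: "length w = n" "set w \<subseteq> {1..m}"
  let ?u = "word_vec (take j w)" and ?v = "word_vec (drop j w)"
  have u: "?u \<in> Vpow m j" using w assms set_take_subset[of j w] by (auto simp: words_def)
  have R: "R_at i ?u \<in> Vpow m j" using u assms by auto
  have "R_at i (R_at j (?u * ?v)) = R_at j (R_at i (?u * ?v))"
    using R_at_mult_right[OF u, of 0] R_at_mult_right[OF R, of 0] R_at_mult_left[OF u] assms by simp
  then show "R_at i (R_at j (word_vec w)) = R_at j (R_at i (word_vec w))"
    by (simp flip: word_vec_append)
qed

subsection \<open>Moving a tensor factor to the front\<close>

text \<open>This pulls the factor at position \<open>s\<close>, counted from zero, to the front.
  With the index shifted, \<open>D (n + s)\<close> is \<open>D n\<close> after the copy of
  \<open>D s\<close> on the factors from position \<open>n\<close> on.\<close>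

definition D :: "nat \<Rightarrow> tens \<Rightarrow> tens"
  where "D s = d_map (Suc s)"

lemma D_0 [simp]: "D 0 x = x"
  by (simp add: D_def d_map_def)

lemma D_Suc: "D (Suc s) x = D s (R_at s x)"
proof -
  \<comment> \<open>The new operator sits at the inner end of the composition and is applied
    first.\<close>
  have "foldr (\<circ>) fs g y = foldr (\<circ>) fs id (g y)" for fs and g :: "tens \<Rightarrow> tens" and y
    by (induction fs) auto
  from this[of _ "R_at s"] show ?thesis by (simp add: D_def d_map_def)
qed

lemma sigma_D: "\<sigma> n x = (\<Sum>s<n. smul ((-1) ^ s) (D s x))"
  unfolding \<sigma>_def D_def
  by (rule sum.reindex_bij_witness[where i = Suc and j = "\<lambda>k. k - 1"]) auto

lemma lin_D: "lin (D s)"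
proof (induction s)
  case (Suc s)
  then show ?case unfolding D_Suc[abs_def] by (rule lin_comp[OF _ lin_R_at])
qed (auto intro!: linI)

lemma lin_sigma: "lin (\<sigma> n)"
  unfolding sigma_D[abs_def] by (intro lin_sum_comp lin_smul_comp lin_D)

lemma D_in_Vpow [intro]: "x \<in> Vpow m n \<Longrightarrow> s < n \<Longrightarrow> D s x \<in> Vpow m n"
proof (induction s arbitrary: x)
  case (Suc s)
  then show ?case using R_at_in_Vpow[of x m n s] by (simp add: D_Suc)
qed simp

lemma sigma_in_Vpow [intro]: "x \<in> Vpow m n \<Longrightarrow> a \<le> n \<Longrightarrow> \<sigma> a x \<in> Vpow m n"
  unfolding sigma_D by (intro Vpow_closed D_in_Vpow) auto

lemma D_mult_left: "x \<in> Vpow m n \<Longrightarrow> s < n \<Longrightarrow> D s (x * y) = D s x * y"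
proof (induction s arbitrary: x)
  case (Suc s)
  then show ?case
    using R_at_mult_left[of x m n s y] R_at_in_Vpow[of x m n s] by (simp add: D_Suc)
qed simp

lemma D_mult_right: "x \<in> Vpow m n \<Longrightarrow> D (n + s) (x * y) = D n (x * D s y)"
proof (induction s arbitrary: y)
  case (Suc s)
  then show ?case using R_at_mult_right[of x m n s y] by (simp add: D_Suc)
qed simp

lemma sigma_mult_left: "x \<in> Vpow m n \<Longrightarrow> a \<le> n \<Longrightarrow> \<sigma> a (x * y) = \<sigma> a x * y"
  unfolding sigma_D sum_distrib_right
  by (intro sum.cong refl) (simp add: D_mult_left[of x m n] smul_mult_left)

text \<open>The summands with \<open>s < a\<close> touch \<open>x\<close> only. For
  \<open>s = a + t\<close> the operator first acts as \<open>D t\<close> on \<open>y\<close> and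
  then carries the resulting front factor across \<open>x\<close>.\<close>

lemma sigma_Leibniz:
  assumes "x \<in> Vpow m a"
  shows "\<sigma> (a + b) (x * y) = \<sigma> a x * y + smul ((-1) ^ a) (D a (x * \<sigma> b y))"
proof -
  have "{..<a + b} = {..<a} \<union> {a..<a + b}" "{..<a} \<inter> {a..<a + b} = {}" by auto
  then have "\<sigma> (a + b) (x * y) = \<sigma> a (x * y) + (\<Sum>s=a..<a + b. smul ((-1) ^ s) (D s (x * y)))"
    by (simp add: sigma_D sum.union_disjoint)
  also have "(\<Sum>s=a..<a + b. smul ((-1) ^ s) (D s (x * y)))
      = (\<Sum>s<b. smul ((-1) ^ (a + s)) (D (a + s) (x * y)))"
    by (rule sum.reindex_bij_witness[where i = "\<lambda>s. a + s" and j = "\<lambda>s. s - a"]) auto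
  also have "\<dots> = smul ((-1) ^ a) (D a (x * \<sigma> b y))"
    by (simp add: sigma_D D_mult_right[OF assms] sum_distrib_left smul_mult_right
        lin_sum[OF lin_D] lin_smul[OF lin_D] pm.scale_sum_right power_add)
  finally show ?thesis by (simp add: sigma_mult_left[OF assms])
qed

lemma D_inj: "x \<in> Vpow m n \<Longrightarrow> s < n \<Longrightarrow> D s x = 0 \<Longrightarrow> x = 0"
proof (induction s arbitrary: x)
  case (Suc s)
  have "R_at s x = 0"
    using Suc.prems Suc.IH[of "R_at s x"] R_at_in_Vpow[of x m n s] by (simp add: D_Suc)
  then show ?case using R_at_inj[of x m n s] Suc.prems by simp
qed simp

lemma D_surj: "z \<in> Vpow m n \<Longrightarrow> s < n \<Longrightarrow> \<exists>x\<in>Vpow m n. D s x = z"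
proof (induction s arbitrary: z)
  case (Suc s)
  then obtain x where "x \<in> Vpow m n" "D s x = z" by (metis Suc_lessD)
  then show ?case using R_at_surj[of x m n s] Suc.prems by (auto simp: D_Suc)
qed auto

lemma D_R_at_far:
  "x \<in> Vpow m n \<Longrightarrow> s < j \<Longrightarrow> j + 2 \<le> n \<Longrightarrow> D s (R_at j x) = R_at j (D s x)"
proof (induction s arbitrary: x)
  case (Suc s)
  then show ?case
    using R_at_commute[of x m n s j] R_at_in_Vpow[of x m n s] by (simp add: D_Suc)
qed simp

text \<open>Sliding a crossing through the moving strand shifts it by one place. The braid relation
  enters where the strand meets the crossing; elsewhere the operators commute.\<close>

lemma D_R_at:
  "x \<in> Vpow m n \<Longrightarrow> i + 2 \<le> s \<Longrightarrow> s < n \<Longrightarrow> D s (R_at i x) = R_at (Suc i) (D s x)"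
proof (induction s arbitrary: x)
  case (Suc s)
  show ?case
  proof (cases "i + 2 \<le> s")
    case True
    then show ?thesis
      using Suc.prems Suc.IH[of "R_at s x"] R_at_commute[of x m n i s] R_at_in_Vpow[of x m n s]
      by (simp add: D_Suc)
  next
    case False
    with Suc.prems have s: "s = Suc i" by simp
    have "D i (R_at i (R_at (Suc i) (R_at i x))) = D i (R_at (Suc i) (R_at i (R_at (Suc i) x)))"
      using Suc.prems s by (subst R_at_braid[of x m n]) auto
    also have "\<dots> = R_at (Suc i) (D i (R_at i (R_at (Suc i) x)))"
      using Suc.prems s by (intro D_R_at_far[where m = m and n = n] R_at_in_Vpow) auto
    finally show ?thesis by (simp add: D_Suc s)
  qed
qed simp

text \<open>This is id \<otimes> \<open>D t\<close>: every crossing is moved one place to the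
  right.\<close>

primrec shift_D :: "nat \<Rightarrow> tens \<Rightarrow> tens" where
  "shift_D 0 x = x"
| "shift_D (Suc t) x = shift_D t (R_at (Suc t) x)"

lemma shift_D_mult: "v \<in> Vpow m (Suc 0) \<Longrightarrow> shift_D t (v * x) = v * D t x"
proof (induction t arbitrary: x)
  case (Suc t)
  then show ?case using R_at_mult_right[of v m "Suc 0" t x] by (simp add: D_Suc)
qed simp

text \<open>\<open>D_R_at\<close> is applied to the crossings of \<open>D t\<close> one after the
  other.\<close>

lemma D_D: "x \<in> Vpow m n \<Longrightarrow> t < s \<Longrightarrow> s < n \<Longrightarrow> D s (D t x) = shift_D t (D s x)"
proof (induction t arbitrary: x)
  case (Suc t)
  then show ?case
    using D_R_at[of x m n t s] R_at_in_Vpow[of x m n t] by (simp add: D_Suc)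
qed simp

lemma word_vec_letter: "i \<in> {1..m} \<Longrightarrow> word_vec [i] \<in> Vpow m (Suc 0)"
  by (auto simp: words_def)

text \<open>Conjugation by \<^term>\<open>D s\<close> turns \<open>\<sigma> s \<otimes> id\<close> into \<open>id \<otimes> \<sigma> s\<close>.\<close>

lemma D_sigma:
  assumes "x \<in> Vpow m (Suc s)"
  shows "D s (\<sigma> s x) = (\<Sum>i\<in>{1..m}. word_vec [i] * \<sigma> s (lquot [i] (D s x)))"
proof -
  define z where "z = D s x"
  have z: "z \<in> Vpow m (Suc s)" using assms by (auto simp: z_def)
  have lin: "lin (shift_D t)" for t
    by (induction t) (auto intro!: linI simp: linD linD[OF lin_R_at])
  have "D s (\<sigma> s x) = (\<Sum>t<s. smul ((-1) ^ t) (shift_D t z))"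
    using assms by (simp add: sigma_D lin_sum[OF lin_D] lin_smul[OF lin_D] D_D z_def)
  \<comment> \<open>With the first letter split off, \<open>shift_D t\<close> acts on the rest as
    \<open>D t\<close>.\<close>
  also have "\<dots> = (\<Sum>t<s. smul ((-1) ^ t) (shift_D t (\<Sum>i\<in>{1..m}. word_vec [i] * lquot [i] z)))"
    by (simp only: lquot_expand[OF z])
  also have "\<dots> = (\<Sum>t<s. \<Sum>i\<in>{1..m}. word_vec [i] * smul ((-1) ^ t) (D t (lquot [i] z)))"
    unfolding lin_sum[OF lin] pm.scale_sum_right
    by (intro sum.cong refl) (metis shift_D_mult[OF word_vec_letter] smul_mult_right)
  also have "\<dots> = (\<Sum>i\<in>{1..m}. word_vec [i] * \<sigma> s (lquot [i] z))"
    by (subst sum.swap) (simp add: sigma_D sum_distrib_left)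
  finally show ?thesis by (simp add: z_def)
qed

text \<open>On a tensor of degree \<open>s + 1\<close>, \<open>\<sigma> s\<close> acts as \<sigma>
  \<otimes> id and leaves the last letter alone.\<close>

lemma sigma_rquot:
  assumes "x \<in> Vpow m (Suc s)"
  shows "\<sigma> s x = (\<Sum>i\<in>{1..m}. \<sigma> s (rquot i x) * word_vec [i])"
  by (subst rquot_expand[OF assms, symmetric], subst lin_sum[OF lin_sigma])
    (intro sum.cong refl sigma_mult_left[OF rquot_in_Vpow[OF assms]] order_refl)

subsection \<open>The kernels\<close>

lemma subspace_ker: "pm.subspace (ker\<sigma> m n)"
  by (auto simp: pm.subspace_def ker\<sigma>_def linD[OF lin_sigma] lin_zero[OF lin_sigma])

lemmas ker_closed [intro] =
  pm.subspace_0[OF subspace_ker] pm.subspace_add[OF subspace_ker]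
  pm.subspace_diff[OF subspace_ker] pm.subspace_scale[OF subspace_ker]
  pm.subspace_sum[OF subspace_ker]

lemma ker_Vpow: "x \<in> ker\<sigma> m n \<Longrightarrow> x \<in> Vpow m n"
  by (simp add: ker\<sigma>_def)

lemma ker_0: "ker\<sigma> m 0 = Vpow m 0"
  by (auto simp: ker\<sigma>_def sigma_D)

lemma one_in_ker [intro]: "1 \<in> ker\<sigma> m 0"
  unfolding ker_0 Vpow_0 by (metis pm.scale_one rangeI)

lemma sigma_1: "\<sigma> (Suc 0) x = x"
  by (simp add: sigma_D)

lemma ker_1: "ker\<sigma> m (Suc 0) = {0}"
  by (auto simp: ker\<sigma>_def sigma_1)

lemma ker_mult [intro]:
  assumes "x \<in> ker\<sigma> m a" "y \<in> ker\<sigma> m b"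
  shows "x * y \<in> ker\<sigma> m (a + b)"
  using assms sigma_Leibniz[of x m a b y] by (auto simp: ker\<sigma>_def lin_zero[OF lin_D])

text \<open>The product \<open>u * word_vec [i]\<close> is killed by \<sigma> \<otimes> id, so by
  \<open>D_sigma\<close> its image under \<open>D s\<close> is killed by id \<otimes> \<sigma>.
  Distinct first letters are independent, so the cofactor of each one lies in the kernel.\<close>

lemma D_ker_letter:
  assumes "u \<in> ker\<sigma> m s" "i \<in> {1..m}" "j \<in> {1..m}"
  shows "lquot [j] (D s (u * word_vec [i])) \<in> ker\<sigma> m s"
proof -
  let ?x = "u * word_vec [i]"
  have x: "?x \<in> Vpow m (Suc s)"
    using Vpow_mult[OF ker_Vpow[OF assms(1)] word_vec_letter[OF assms(2)]] by simp
  have "\<sigma> s ?x = 0"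
    using assms sigma_mult_left[of u m s s "word_vec [i]"] by (simp add: ker\<sigma>_def)
  then have "(\<Sum>i\<in>{1..m}. word_vec [i] * \<sigma> s (lquot [i] (D s ?x))) = 0"
    using D_sigma[OF x] by (simp add: lin_zero[OF lin_D])
  then have "\<sigma> s (lquot [j] (D s ?x)) = 0"
    by (rule sum_left_letters_zero) (use assms in auto)
  moreover have "lquot [j] (D s ?x) \<in> Vpow m s"
    using x by (intro lquot_in_Vpow) auto
  ultimately show ?thesis by (simp add: ker\<sigma>_def)
qed

text \<open>The witness \<open>k'\<close> is the braided commutator of \<open>v\<^sub>i\<close> and \<open>k\<close>.\<close>

lemma letter_mult_ker:
  assumes k: "k \<in> ker\<sigma> m s" and i: "i \<in> {1..m}"
  shows "\<exists>k' u. k' \<in> ker\<sigma> m (Suc s) \<and> (\<forall>j\<in>{1..m}. u j \<in> ker\<sigma> m s) \<and>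
    word_vec [i] * k = k' + (\<Sum>j\<in>{1..m}. u j * word_vec [j])"
proof -
  let ?z = "word_vec [i] * k"
  have z: "?z \<in> Vpow m (Suc s)"
    using Vpow_mult[OF word_vec_letter[OF i] ker_Vpow[OF k]] by simp
  \<comment> \<open>Undoing the braiding moves the letter to the right end: id \<otimes> \<sigma>
    kills \<open>?z\<close>, so \<sigma> \<otimes> id kills \<open>x\<close>, and its right
    cofactors lie in the kernel.\<close>
  obtain x where x: "x \<in> Vpow m (Suc s)" "D s x = ?z"
    using D_surj[OF z, of s] by auto
  have "(\<Sum>j\<in>{1..m}. word_vec [j] * \<sigma> s (lquot [j] ?z)) = 0"
    using k by (intro sum.neutral) (auto simp: lquot_mult_left lin_zero[OF lin_sigma] ker\<sigma>_def)
  then have "D s (\<sigma> s x) = 0" using D_sigma[OF x(1)] x(2) by simp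
  then have sx: "\<sigma> s x = 0" using x(1) by (intro D_inj[of "\<sigma> s x" m "Suc s" s]) auto
  then have "(\<Sum>i\<in>{1..m}. \<sigma> s (rquot i x) * word_vec [i]) = 0"
    using sigma_rquot[OF x(1)] by simp
  then have u: "rquot j x \<in> ker\<sigma> m s" if "j \<in> {1..m}" for j
    using sum_right_letters_zero[of "\<lambda>i. \<sigma> s (rquot i x)" "{1..m}" j] that rquot_in_Vpow[OF x(1)]
    by (simp add: ker\<sigma>_def)
  \<comment> \<open>The sign comes from \<open>\<sigma> (Suc s) x = smul ((-1) ^ s) ?z\<close>,
    while \<open>\<sigma> (Suc s)\<close> fixes \<open>?z\<close>.\<close>
  let ?k' = "?z - smul ((-1) ^ s) x"
  have "\<sigma> (Suc s) x = \<sigma> s x + smul ((-1) ^ s) (D s x)" by (simp add: sigma_D)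
  then have "smul ((-1) ^ s) (\<sigma> (Suc s) x) = ?z"
    by (simp add: sx x(2) flip: power_add)
  moreover have "\<sigma> (Suc s) ?z = ?z"
    using sigma_Leibniz[OF word_vec_letter[OF i], of s k] k
    by (simp add: sigma_1 ker\<sigma>_def lin_zero[OF lin_D])
  ultimately have "?k' \<in> ker\<sigma> m (Suc s)"
    using z x by (auto simp: ker\<sigma>_def lin_minus[OF lin_sigma] lin_smul[OF lin_sigma])
  moreover have "?z = ?k' + (\<Sum>j\<in>{1..m}. smul ((-1) ^ s) (rquot j x) * word_vec [j])"
    using rquot_expand[OF x(1)] by (simp add: smul_mult_left flip: pm.scale_sum_right)
  ultimately show ?thesis using u by (intro exI[of _ ?k'] exI conjI) auto
qed

subsection \<open>Decreasing words generate\<close>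

text \<open>Strictly decreasing words are indexed by their sets of letters, so that those of length
  j are counted by a binomial coefficient.\<close>

definition decr_vec :: "nat set \<Rightarrow> tens"
  where "decr_vec S = word_vec (rev (sorted_list_of_set S))"

lemma decr_vec_empty [simp]: "decr_vec {} = 1"
  by (simp add: decr_vec_def)

lemma decr_vec_insert:
  assumes "finite S" "\<And>j. j \<in> S \<Longrightarrow> j < i"
  shows "decr_vec (insert i S) = word_vec [i] * decr_vec S"
proof -
  have "i \<notin> S" using assms(2) by auto
  then have "sorted_list_of_set (insert i S) = sorted_list_of_set S @ [i]"
    using assms sorted_list_of_set.idem_if_sorted_distinct[of "sorted_list_of_set S @ [i]"]
    by (simp add: sorted_append less_imp_le)
  then show ?thesis by (simp add: decr_vec_def word_vec_Cons[of i "rev _"])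
qed

lemma decr_vec_in_Vpow:
  assumes "S \<subseteq> {1..m}"
  shows "decr_vec S \<in> Vpow m (card S)"
proof -
  have "finite S" using assms finite_subset by blast
  then show ?thesis
    using assms by (auto simp: decr_vec_def words_def intro!: word_vec_in_Vpow)
qed

text \<open>The degree \<open>n\<close> part of the right ideal of T(V) generated by the kernels of
  positive degree.\<close>

definition ker_ideal :: "nat \<Rightarrow> nat \<Rightarrow> tens set"
  where "ker_ideal m n =
    pm.span {k * t |k t a b. 0 < a \<and> a + b = n \<and> k \<in> ker\<sigma> m a \<and> t \<in> Vpow m b}"

lemma ker_idealI:
  "0 < a \<Longrightarrow> a + b = n \<Longrightarrow> k \<in> ker\<sigma> m a \<Longrightarrow> t \<in> Vpow m b \<Longrightarrow> k * t \<in> ker_ideal m n"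
  unfolding ker_ideal_def by (rule pm.span_base) blast

lemma subspace_ker_ideal: "pm.subspace (ker_ideal m n)"
  by (simp add: ker_ideal_def)

text \<open>By \<open>letter_mult_ker\<close> a letter can be moved to the right of kernel elements,
  so the right ideal is two-sided.\<close>

lemma letter_mult_ker_ideal:
  assumes i: "i \<in> {1..m}" and x: "x \<in> ker_ideal m n"
  shows "word_vec [i] * x \<in> ker_ideal m (Suc n)"
proof (rule lin_span_subset[OF lin_mult_left subspace_ker_ideal _ x[unfolded ker_ideal_def]])
  fix x
  assume "x \<in> {k * t |k t a b. 0 < a \<and> a + b = n \<and> k \<in> ker\<sigma> m a \<and> t \<in> Vpow m b}"
  then obtain k t a b where *: "x = k * t" "0 < a" "a + b = n" "k \<in> ker\<sigma> m a" "t \<in> Vpow m b"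
    by blast
  obtain k' u where ku: "k' \<in> ker\<sigma> m (Suc a)" "\<And>j. j \<in> {1..m} \<Longrightarrow> u j \<in> ker\<sigma> m a"
    "word_vec [i] * k = k' + (\<Sum>j\<in>{1..m}. u j * word_vec [j])"
    using letter_mult_ker[OF *(4) i] by blast
  have "word_vec [i] * x = k' * t + (\<Sum>j\<in>{1..m}. u j * (word_vec [j] * t))"
    by (simp only: * mult.assoc[symmetric] ku distrib_right sum_distrib_right)
  also have "\<dots> \<in> ker_ideal m (Suc n)"
  proof (intro pm.subspace_add[OF subspace_ker_ideal] pm.subspace_sum[OF subspace_ker_ideal])
    show "k' * t \<in> ker_ideal m (Suc n)"
      using * ku by (intro ker_idealI[of "Suc a" b]) auto
    fix j assume j: "j \<in> {1..m}"
    have "word_vec [j] * t \<in> Vpow m (Suc b)"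
      using Vpow_mult[OF word_vec_letter[OF j] *(5)] by simp
    then show "u j * (word_vec [j] * t) \<in> ker_ideal m (Suc n)"
      using * ku(2)[OF j] by (intro ker_idealI[of a "Suc b"]) auto
  qed
  finally show "word_vec [i] * x \<in> ker_ideal m (Suc n)" .
qed

text \<open>As \<open>\<sigma> 2\<close> is 1 - R, these are fixed vectors of R. Modulo them the
  letters behave as in a quantum exterior algebra: squares vanish and increasing pairs turn into
  decreasing ones.\<close>

lemma quadratic_ker:
  assumes "i \<in> {1..m}" "j \<in> {1..m}"
  shows "word_vec [i, i] \<in> ker\<sigma> m 2"
    and "i < j \<Longrightarrow> word_vec [i, j] + smul (y_K\<^sup>2) (word_vec [j, i]) \<in> ker\<sigma> m 2"
proof -
  have D: "D (Suc 0) x = R_at 0 x" for x using D_Suc[of 0 x] by simp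
  have 2: "\<sigma> 2 x = x - R_at 0 x" for x
    by (simp add: sigma_D numeral_2_eq_2 D)
  have R: "R_at 0 (word_vec [a, b]) = (if a < b
    then smul (1 - y_K\<^sup>2) (word_vec [a, b]) + smul (y_K\<^sup>2) (word_vec [b, a])
    else word_vec [b, a])" for a b
    using R_at_word[of "[]" 0 a b "[]"] by simp
  have V: "word_vec [i, i] \<in> Vpow m 2" "word_vec [i, j] \<in> Vpow m 2" "word_vec [j, i] \<in> Vpow m 2"
    using assms by (auto simp: words_def intro!: word_vec_in_Vpow)
  then show "word_vec [i, i] \<in> ker\<sigma> m 2" by (simp add: ker\<sigma>_def 2 R)
  assume "i < j"
  then have "\<sigma> 2 (word_vec [i, j] + smul (y_K\<^sup>2) (word_vec [j, i])) = 0"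
    by (simp add: 2 R linD[OF lin_R_at]) (auto intro!: poly_mapping_eqI simp: lookup_add lookup_minus algebra_simps)
  then show "word_vec [i, j] + smul (y_K\<^sup>2) (word_vec [j, i]) \<in> ker\<sigma> m 2"
    using V by (auto simp: ker\<sigma>_def)
qed

definition decr_vecs :: "nat \<Rightarrow> nat \<Rightarrow> tens set"
  where "decr_vecs r n = {decr_vec S |S. S \<subseteq> {1..r} \<and> card S = n}"

text \<open>Insertion sort modulo the ideal. The bound \<open>r\<close> on the letters of the result
  is tracked separately from \<open>m\<close> for the sake of the induction.\<close>

lemma letter_mult_decr_vec:
  assumes "finite S" "i \<in> {1..r}" "S \<subseteq> {1..r}" "r \<le> m"
  shows "word_vec [i] * decr_vec S
    \<in> pm.span (decr_vecs r (Suc (card S)) \<union> ker_ideal m (Suc (card S)))"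
  using assms
proof (induction S arbitrary: i r rule: finite_linorder_max_induct)
  case empty
  have "decr_vec {i} \<in> decr_vecs r (Suc 0)"
    unfolding decr_vecs_def using empty by (intro CollectI exI[of _ "{i}"]) auto
  then show ?case using decr_vec_insert[of "{}" i] by (simp add: pm.span_base)
next
  case (insert b A)
  let ?U = "pm.span (decr_vecs r (Suc (Suc (card A))) \<union> ker_ideal m (Suc (Suc (card A))))"
  have bA: "b \<notin> A" "card (insert b A) = Suc (card A)" "decr_vec (insert b A) = word_vec [b] * decr_vec A"
    using insert.hyps by (auto simp: decr_vec_insert)
  have A: "decr_vec A \<in> Vpow m (card A)"
    using insert.prems by (intro decr_vec_in_Vpow) auto
  have b: "b \<in> {1..m}" and i: "i \<in> {1..m}" using insert.prems by auto
  have ideal: "k * decr_vec A \<in> ?U" if "k \<in> ker\<sigma> m 2" for k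
    using that A by (intro pm.span_base UnI2 ker_idealI[of 2 "card A"]) auto
  have "word_vec [i] * decr_vec (insert b A) \<in> ?U"
  proof (cases i b rule: linorder_cases)
    case greater
    then have "word_vec [i] * decr_vec (insert b A) = decr_vec (insert i (insert b A))"
      using insert.hyps by (intro decr_vec_insert[symmetric]) auto
    moreover have "card (insert i (insert b A)) = Suc (Suc (card A))"
      using greater insert.hyps by (subst card_insert_disjoint) auto
    then have "decr_vec (insert i (insert b A)) \<in> decr_vecs r (Suc (Suc (card A)))"
      unfolding decr_vecs_def using insert.prems by blast
    ultimately show ?thesis by (simp add: pm.span_base)
  next
    case equal
    have "word_vec [i] * decr_vec (insert b A) = word_vec [i, i] * decr_vec A"
      using equal bA by (simp add: word_vec_Cons[of b "[b]"] mult.assoc)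
    then show ?thesis using ideal[OF quadratic_ker(1)[OF i i]] by simp
  next
    case less
    \<comment> \<open>The quadratic relation exchanges \<open>i\<close> with the leading letter
      \<open>b\<close> at the price of a term in the ideal.\<close>
    let ?k = "word_vec [i, b] + smul (y_K\<^sup>2) (word_vec [b, i])"
    have "word_vec [i] * decr_vec (insert b A)
        = ?k * decr_vec A - smul (y_K\<^sup>2) (word_vec [b] * (word_vec [i] * decr_vec A))"
      by (simp add: bA word_vec_Cons[of i "[b]"] word_vec_Cons[of b "[i]"] mult.assoc
          distrib_right smul_mult_left)
    moreover have "?k * decr_vec A \<in> ?U"
      using quadratic_ker(2)[OF i b less] by (rule ideal)
    moreover have "word_vec [b] * (word_vec [i] * decr_vec A) \<in> ?U"
    proof (rule lin_span_subset[OF lin_mult_left pm.subspace_span])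
      \<comment> \<open>The bound \<open>b - 1\<close> keeps the decreasing words arising here below
        \<open>b\<close>, so prepending \<open>b\<close> gives decreasing words again.\<close>
      show "word_vec [i] * decr_vec A
          \<in> pm.span (decr_vecs (b - 1) (Suc (card A)) \<union> ker_ideal m (Suc (card A)))"
      proof (rule insert.IH)
        show "i \<in> {1..b - 1}" "b - 1 \<le> m" using less i b by auto
        show "A \<subseteq> {1..b - 1}" using insert.hyps(2) insert.prems(2) by fastforce
      qed
      fix x assume "x \<in> decr_vecs (b - 1) (Suc (card A)) \<union> ker_ideal m (Suc (card A))"
      then show "word_vec [b] * x \<in> ?U"
      proof
        assume "x \<in> ker_ideal m (Suc (card A))"
        then show ?thesis using letter_mult_ker_ideal[OF b] by (intro pm.span_base) auto
      next
        assume "x \<in> decr_vecs (b - 1) (Suc (card A))"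
        then obtain S where S: "x = decr_vec S" "S \<subseteq> {1..b - 1}" "card S = Suc (card A)"
          by (auto simp: decr_vecs_def)
        have fS: "finite S" using S(2) finite_subset by blast
        have lt: "\<And>j. j \<in> S \<Longrightarrow> j < b" using S(2) b by fastforce
        then have "b \<notin> S" by auto
        then have "word_vec [b] * x = decr_vec (insert b S)" "card (insert b S) = Suc (Suc (card A))"
          using S fS decr_vec_insert[OF fS lt] by auto
        moreover have "insert b S \<subseteq> {1..r}" using S(2) b insert.prems by fastforce
        ultimately show ?thesis
          unfolding decr_vecs_def by (intro pm.span_base UnI1) blast
      qed
    qed
    ultimately show ?thesis by (metis pm.span_diff pm.span_scale)
  qed
  then show ?case by (simp only: bA)
qed

text \<open>Words are built up from the right; each new letter is sorted into the decreasing words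
  or absorbed by the ideal.\<close>

lemma Vpow_decr_ker_ideal:
  assumes "x \<in> Vpow m n"
  shows "x \<in> pm.span (decr_vecs m n \<union> ker_ideal m n)"
proof -
  have "word_vec w \<in> pm.span (decr_vecs m (length w) \<union> ker_ideal m (length w))"
    if "set w \<subseteq> {1..m}" for w
    using that
  proof (induction w)
    case Nil
    have "decr_vec {} \<in> decr_vecs m 0" unfolding decr_vecs_def by force
    then show ?case by (simp add: pm.span_base)
  next
    case (Cons i w)
    have i: "i \<in> {1..m}" using Cons.prems by auto
    have "word_vec [i] * word_vec w
        \<in> pm.span (decr_vecs m (Suc (length w)) \<union> ker_ideal m (Suc (length w)))"
    proof (rule lin_span_subset[OF lin_mult_left pm.subspace_span])
      show "word_vec w \<in> pm.span (decr_vecs m (length w) \<union> ker_ideal m (length w))"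
        using Cons by simp
      fix x assume "x \<in> decr_vecs m (length w) \<union> ker_ideal m (length w)"
      then show "word_vec [i] * x \<in> pm.span (decr_vecs m (Suc (length w)) \<union> ker_ideal m (Suc (length w)))"
      proof
        assume "x \<in> ker_ideal m (length w)"
        then show ?thesis using letter_mult_ker_ideal[OF i] by (intro pm.span_base) auto
      next
        assume "x \<in> decr_vecs m (length w)"
        then obtain S where S: "x = decr_vec S" "S \<subseteq> {1..m}" "card S = length w"
          by (auto simp: decr_vecs_def)
        then have "finite S" using finite_subset by blast
        then show ?thesis using letter_mult_decr_vec[of S i m m] i S by simp
      qed
    qed
    then show ?case by (simp flip: word_vec_Cons)
  qed
  then show ?thesis
    using assms by (intro Vpow_linI[OF lin_id pm.subspace_span, of x m n, unfolded id_apply]) auto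
qed

text \<open>A graded Nakayama argument: in an element \<open>k * t\<close> of the ideal,
  \<open>k\<close> has positive degree, so \<open>t\<close> expands by induction and
  \<open>k\<close> merges with the coefficients because kernels multiply into kernels.\<close>

lemma Vpow_ker_decr:
  "x \<in> Vpow m n \<Longrightarrow>
    x \<in> pm.span {k * decr_vec S |k S. S \<subseteq> {1..m} \<and> card S \<le> n \<and> k \<in> ker\<sigma> m (n - card S)}"
  (is "_ \<Longrightarrow> x \<in> pm.span (?M n)")
proof (induction n arbitrary: x rule: less_induct)
  case (less n)
  have base: "decr_vecs m n \<subseteq> ?M n"
  proof
    fix x assume "x \<in> decr_vecs m n"
    then obtain S where "x = decr_vec S" "S \<subseteq> {1..m}" "card S = n"
      by (auto simp: decr_vecs_def)
    then show "x \<in> ?M n" by (intro CollectI exI[of _ 1] exI[of _ S]) auto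
  qed
  have "k * t \<in> pm.span (?M n)"
    if kt: "0 < a" "a + b = n" "k \<in> ker\<sigma> m a" "t \<in> Vpow m b" for k t a b
  proof (rule lin_span_subset[OF lin_mult_left pm.subspace_span])
    show "t \<in> pm.span (?M b)" using kt by (intro less.IH) auto
    fix x assume "x \<in> ?M b"
    then obtain k' S where S: "x = k' * decr_vec S" "S \<subseteq> {1..m}" "card S \<le> b"
      "k' \<in> ker\<sigma> m (b - card S)" by auto
    have "k * k' \<in> ker\<sigma> m (a + (b - card S))" using kt S by blast
    moreover have "a + (b - card S) = n - card S" using kt S by simp
    ultimately have "k * k' * decr_vec S \<in> ?M n"
      using S kt by (intro CollectI exI[of _ "k * k'"] exI[of _ S]) simp
    then show "k * x \<in> pm.span (?M n)" by (simp add: S(1) mult.assoc pm.span_base)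
  qed
  then have "ker_ideal m n \<subseteq> pm.span (?M n)"
    unfolding ker_ideal_def by (intro pm.span_minimal pm.subspace_span) blast
  then have "pm.span (decr_vecs m n \<union> ker_ideal m n) \<subseteq> pm.span (?M n)"
    using base pm.span_superset by (intro pm.span_minimal pm.subspace_span) blast
  then show ?case using Vpow_decr_ker_ideal[OF less.prems] by blast
qed

subsection \<open>Decreasing words are linearly independent over the kernels\<close>

text \<open>The exponent is the position of \<open>i\<close> in the decreasing word on
  \<open>S\<close>, counted from zero.\<close>

definition decr_sign :: "nat set \<Rightarrow> nat \<Rightarrow> K"
  where "decr_sign S i = (-1) ^ card {j \<in> S. i < j}"

text \<open>On a decreasing pair of letters R is a plain swap, so each summand of \<sigma> just
  carries one letter to the front. The induction splits off the largest letter by the Leibniz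
  rule.\<close>

lemma sigma_decr_vec:
  assumes "finite S" "S \<subseteq> {1..m}"
  shows "\<sigma> (card S) (decr_vec S)
    = (\<Sum>i\<in>S. smul (decr_sign S i) (word_vec [i] * decr_vec (S - {i})))"
  using assms
proof (induction S rule: finite_linorder_max_induct)
  case empty
  then show ?case by (simp add: sigma_D)
next
  case (insert b A)
  have bA: "b \<notin> A" "card (insert b A) = Suc (card A)" "decr_vec (insert b A) = word_vec [b] * decr_vec A"
    using insert.hyps by (auto simp: decr_vec_insert)
  have b: "b \<in> {1..m}" using insert.prems by auto
  have sign_b: "decr_sign (insert b A) b = 1"
  proof -
    have "{j \<in> insert b A. b < j} = {}" using insert.hyps(2) by auto
    then show ?thesis by (simp only: decr_sign_def card.empty power_0)
  qed
  \<comment> \<open>The new largest letter stands to the left of every \<open>i\<close> in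
    \<open>A\<close>.\<close>
  have sign: "decr_sign (insert b A) i = - decr_sign A i" if "i \<in> A" for i
  proof -
    have "{j \<in> insert b A. i < j} = insert b {j \<in> A. i < j}" using insert.hyps that by auto
    then show ?thesis using insert.hyps bA by (simp add: decr_sign_def)
  qed
  have D: "D (Suc 0) (word_vec [b] * (word_vec [i] * decr_vec (A - {i})))
      = word_vec [i] * decr_vec (insert b A - {i})" if i: "i \<in> A" for i
  proof -
    have ib: "i < b" "i \<noteq> b" using i insert.hyps(2) by auto
    have "[b, i] \<in> words m 2" using i insert.prems b by (auto simp: words_def)
    then have V: "word_vec [b, i] \<in> Vpow m 2" by (rule word_vec_in_Vpow)
    have "D (Suc 0) (word_vec [b] * (word_vec [i] * decr_vec (A - {i})))
        = R_at 0 (word_vec [b, i] * decr_vec (A - {i}))"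
      using D_Suc[of 0] by (simp add: word_vec_Cons[of b "[i]"] mult.assoc)
    also have "\<dots> = R_at 0 (word_vec [b, i]) * decr_vec (A - {i})"
      using V by (rule R_at_mult_left) simp
    also have "R_at 0 (word_vec [b, i]) = word_vec [i] * word_vec [b]"
      using R_at_word[of "[]" 0 b i "[]"] ib by (simp add: word_vec_Cons[of i "[b]"])
    also have "\<dots> * decr_vec (A - {i}) = word_vec [i] * decr_vec (insert b (A - {i}))"
      using insert.hyps by (subst decr_vec_insert) (auto simp: mult.assoc)
    also have "insert b (A - {i}) = insert b A - {i}" using ib by auto
    finally show ?thesis .
  qed
  have "\<sigma> (card (insert b A)) (decr_vec (insert b A))
      = word_vec [b] * decr_vec A - D (Suc 0) (word_vec [b] * \<sigma> (card A) (decr_vec A))"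
    using sigma_Leibniz[OF word_vec_letter[OF b], of "card A" "decr_vec A"]
    by (simp add: bA sigma_1)
  also have "\<sigma> (card A) (decr_vec A)
      = (\<Sum>i\<in>A. smul (decr_sign A i) (word_vec [i] * decr_vec (A - {i})))"
    using insert by simp
  also have "D (Suc 0) (word_vec [b] * \<dots>)
      = (\<Sum>i\<in>A. smul (decr_sign A i) (word_vec [i] * decr_vec (insert b A - {i})))"
    by (simp add: sum_distrib_left smul_mult_right lin_sum[OF lin_D] lin_smul[OF lin_D] D)
  also have "word_vec [b] * decr_vec A - \<dots>
      = (\<Sum>i\<in>insert b A. smul (decr_sign (insert b A) i) (word_vec [i] * decr_vec (insert b A - {i})))"
    using insert.hyps bA by (simp add: sign_b sign sum_negf)
  finally show ?case .
qed

text \<open>Applying \<sigma> to a relation deletes letters from the decreasing words; cancelling a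
  first letter from the new coefficients brings them back into the kernels, in total degree one
  less. The second hypothesis covers the sets for which \<open>n - card S\<close> is truncated to
  zero.\<close>

lemma decr_vec_independent:
  assumes "\<And>S. S \<subseteq> {1..m} \<Longrightarrow> card S \<le> n \<Longrightarrow> a S \<in> ker\<sigma> m (n - card S)"
    and "\<And>S. S \<subseteq> {1..m} \<Longrightarrow> n < card S \<Longrightarrow> a S = 0"
    and "(\<Sum>S\<in>Pow {1..m}. a S * decr_vec S) = 0"
    and "S \<subseteq> {1..m}"
  shows "a S = 0"
  using assms
proof (induction n arbitrary: a S)
  case 0
  have "(\<Sum>S\<in>Pow {1..m}. a S * decr_vec S) = (\<Sum>S\<in>{{}}. a S * decr_vec S)"
  proof (rule sum.mono_neutral_right)
    show "\<forall>S\<in>Pow {1..m} - {{}}. a S * decr_vec S = 0"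
    proof
      fix S assume S: "S \<in> Pow {1..m} - {{}}"
      then have "0 < card S" by (auto simp: card_gt_0_iff intro: finite_subset)
      then show "a S * decr_vec S = 0" using 0(2)[of S] S by simp
    qed
  qed auto
  then have "a {} = 0" using 0 by simp
  moreover have "0 < card S" if "S \<noteq> {}"
    using that 0(4) by (auto simp: card_gt_0_iff intro: finite_subset)
  ultimately show ?case using 0(2)[OF 0(4)] by blast
next
  case (Suc n)
  let ?M = "{1..m}"
  have fin: "finite S" if "S \<subseteq> ?M" for S using that finite_subset by blast
  have V: "a S * word_vec [i] \<in> Vpow m (Suc (Suc n - card S))" if "S \<subseteq> ?M" "i \<in> ?M" for S i
  proof (cases "card S \<le> Suc n")
    case True
    from Vpow_mult[OF ker_Vpow[OF Suc.prems(1)[OF that(1) True]] word_vec_letter[OF that(2)]]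
    show ?thesis by simp
  next
    case False
    then show ?thesis using Suc.prems(2)[OF that(1)] by auto
  qed
  \<comment> \<open>The coefficient that \<sigma> leaves in front of
    \<open>decr_vec (S - {i})\<close>; the other term of the Leibniz rule vanishes because
    \<open>a S\<close> is in the kernel.\<close>
  define g where "g S i = smul ((-1) ^ (Suc n - card S) * decr_sign S i)
    (D (Suc n - card S) (a S * word_vec [i]))" for S i
  \<comment> \<open>Coefficients collected by the remaining set: \<open>insert i S\<close>
    contributes to \<open>S\<close> by losing \<open>i\<close>.\<close>
  define z where "z S = (\<Sum>i\<in>?M - S. g (insert i S) i)" for S
  have sigma: "\<sigma> (Suc n) (a S * decr_vec S) = (\<Sum>i\<in>S. g S i * decr_vec (S - {i}))"
    if S: "S \<subseteq> ?M" for S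
  proof (cases "card S \<le> Suc n")
    case False
    then show ?thesis
      using Suc.prems(2)[OF S] by (simp add: g_def lin_zero[OF lin_sigma] lin_zero[OF lin_D])
  next
    case True
    let ?s = "Suc n - card S"
    have ker: "a S \<in> ker\<sigma> m ?s" using Suc.prems(1)[OF S True] .
    have "\<sigma> (Suc n) (a S * decr_vec S) = smul ((-1) ^ ?s) (D ?s (a S * \<sigma> (card S) (decr_vec S)))"
      using sigma_Leibniz[OF ker_Vpow[OF ker], of "card S" "decr_vec S"] True ker
      by (simp add: ker\<sigma>_def)
    also have "\<dots> = (\<Sum>i\<in>S. g S i * decr_vec (S - {i}))"
      unfolding sigma_decr_vec[OF fin[OF S] S] sum_distrib_left lin_sum[OF lin_D] pm.scale_sum_right
    proof (intro sum.cong refl)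
      fix i assume "i \<in> S"
      then have "a S * word_vec [i] \<in> Vpow m (Suc ?s)" using V S by blast
      from D_mult_left[OF this, of ?s "decr_vec (S - {i})"]
      show "smul ((-1) ^ ?s) (D ?s (a S * smul (decr_sign S i) (word_vec [i] * decr_vec (S - {i}))))
          = g S i * decr_vec (S - {i})"
        by (simp add: g_def smul_mult_right smul_mult_left lin_smul[OF lin_D] flip: mult.assoc)
    qed
    finally show ?thesis .
  qed
  have "0 = \<sigma> (Suc n) (\<Sum>S\<in>Pow ?M. a S * decr_vec S)"
    using Suc.prems(3) by (simp add: lin_zero[OF lin_sigma])
  also have "\<dots> = (\<Sum>S\<in>Pow ?M. \<Sum>i\<in>S. g S i * decr_vec (S - {i}))"
    by (simp add: lin_sum[OF lin_sigma] sigma)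
  also have "\<dots> = (\<Sum>(S, i)\<in>Sigma (Pow ?M) (\<lambda>S. S). g S i * decr_vec (S - {i}))"
    using fin by (subst sum.Sigma) auto
  also have "\<dots> = (\<Sum>(S, i)\<in>Sigma (Pow ?M) (\<lambda>S. ?M - S). g (insert i S) i * decr_vec S)"
    by (rule sum.reindex_bij_witness[where i = "\<lambda>(S, i). (insert i S, i)" and j = "\<lambda>(S, i). (S - {i}, i)"])
      (auto simp: insert_absorb)
  also have "\<dots> = (\<Sum>S\<in>Pow ?M. z S * decr_vec S)"
    unfolding z_def sum_distrib_right by (subst sum.Sigma) auto
  finally have zsum: "(\<Sum>S\<in>Pow ?M. z S * decr_vec S) = 0" by simp
  have card: "card (insert i S) = Suc (card S)" if "S \<subseteq> ?M" "i \<in> ?M - S" for S i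
    using that fin by auto
  have z_in: "z S \<in> Vpow m (Suc (n - card S))" if S: "S \<subseteq> ?M" for S
    unfolding z_def
  proof (intro Vpow_closed)
    fix i assume i: "i \<in> ?M - S"
    have "a (insert i S) * word_vec [i] \<in> Vpow m (Suc (n - card S))"
      using V[of "insert i S" i] S i by (simp add: card)
    then show "g (insert i S) i \<in> Vpow m (Suc (n - card S))"
      unfolding g_def card[OF S i] by auto
  qed
  \<comment> \<open>The degree of \<open>z S\<close> is one too high for the induction hypothesis.
    Cancelling a first letter lowers it, and \<open>D_ker_letter\<close> puts the result into the
    kernel.\<close>
  have lz: "lquot [l] (z S) = 0" if l: "l \<in> ?M" and "S \<subseteq> ?M" for l S
    using _ _ _ that(2)
  proof (rule Suc.IH)
    fix S assume S: "S \<subseteq> ?M"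
    {
      assume le: "card S \<le> n"
      show "lquot [l] (z S) \<in> ker\<sigma> m (n - card S)"
        unfolding z_def lin_sum[OF lin_lquot]
      proof (intro ker_closed)
        fix i assume i: "i \<in> ?M - S"
        have "a (insert i S) \<in> ker\<sigma> m (n - card S)"
          using Suc.prems(1)[of "insert i S"] S i le by (simp add: card)
        from D_ker_letter[OF this, of i l]
        show "lquot [l] (g (insert i S) i) \<in> ker\<sigma> m (n - card S)"
          using i l by (auto simp: g_def card[OF S i] lin_smul[OF lin_lquot])
      qed
    next
      assume gt: "n < card S"
      have "g (insert i S) i = 0" if "i \<in> ?M - S" for i
        using Suc.prems(2)[of "insert i S"] gt S that by (simp add: g_def card lin_zero[OF lin_D])
      then show "lquot [l] (z S) = 0" by (simp add: z_def lin_zero[OF lin_lquot])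
    }
  next
    have "0 = lquot [l] (\<Sum>S\<in>Pow ?M. z S * decr_vec S)"
      by (simp only: zsum lin_zero[OF lin_lquot])
    also have "\<dots> = (\<Sum>S\<in>Pow ?M. lquot [l] (z S) * decr_vec S)"
      unfolding lin_sum[OF lin_lquot]
      by (intro sum.cong refl lquot_mult[OF z_in]) auto
    finally show "(\<Sum>S\<in>Pow ?M. lquot [l] (z S) * decr_vec S) = 0" by simp
  qed
  have step: "a (insert i S) = 0" if S: "S \<subseteq> ?M" and i: "i \<in> ?M - S" for S i
  proof (cases "card S \<le> n")
    case False
    then show ?thesis using Suc.prems(2)[of "insert i S"] S i by (simp add: card)
  next
    case True
    \<comment> \<open>The sets \<open>insert i S\<close> all have the same size, so one common
      \<open>D (n - card S)\<close> can be pulled out of \<open>z S\<close> and cancelled. The last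
      letters then separate the coefficients.\<close>
    let ?c = "\<lambda>i. (-1) ^ (n - card S) * decr_sign (insert i S) i"
    let ?x = "\<Sum>i\<in>?M - S. smul (?c i) (a (insert i S)) * word_vec [i]"
    have "D (n - card S) ?x = z S"
      unfolding z_def lin_sum[OF lin_D]
      by (intro sum.cong refl) (use S in \<open>simp add: g_def card smul_mult_left lin_smul[OF lin_D]\<close>)
    also have "z S = 0" using lquot_expand[OF z_in[OF S]] lz[OF _ S] by simp
    finally have "D (n - card S) ?x = 0" .
    moreover have "?x \<in> Vpow m (Suc (n - card S))"
      unfolding smul_mult_left
    proof (intro Vpow_closed)
      fix i assume i: "i \<in> ?M - S"
      show "a (insert i S) * word_vec [i] \<in> Vpow m (Suc (n - card S))"
        using V[of "insert i S" i] S i by (simp add: card)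
    qed
    ultimately have "?x = 0" using D_inj by blast
    then have "smul (?c i) (a (insert i S)) = 0"
      using i by (intro sum_right_letters_zero[of "\<lambda>i. smul (?c i) (a (insert i S))" "?M - S"]) auto
    then show ?thesis by (simp add: decr_sign_def)
  qed
  have nonempty: "a S = 0" if "S \<subseteq> ?M" "S \<noteq> {}" for S
  proof -
    obtain i where "i \<in> S" using \<open>S \<noteq> {}\<close> by auto
    then have "insert i (S - {i}) = S" "S - {i} \<subseteq> ?M" "i \<in> ?M - (S - {i})"
      using that(1) by blast+
    then show ?thesis using step[of "S - {i}" i] by simp
  qed
  \<comment> \<open>The empty set is out of reach of \<open>step\<close>, but its term is
    \<open>a {}\<close> itself.\<close>
  have "(\<Sum>S\<in>Pow ?M. a S * decr_vec S) = (\<Sum>S\<in>{{}}. a S * decr_vec S)"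
    by (rule sum.mono_neutral_right) (auto simp: nonempty)
  then have "a {} = 0" using Suc.prems(3) by simp
  then show ?case using nonempty Suc.prems(4) by blast
qed

subsection \<open>Dimensions of the kernels\<close>

lemma basis_of_Vpow_subspace:
  assumes "pm.subspace U" "U \<subseteq> Vpow m n"
  obtains B where "finite B" "pm.independent B" "pm.span B = U" "card B = pm.dim U"
proof -
  obtain B where B: "B \<subseteq> U" "pm.independent B" "U \<subseteq> pm.span B" "card B = pm.dim U"
    using pm.basis_exists[of U] by blast
  have "B \<subseteq> pm.span (word_vec ` words m n)" using B assms by (auto simp: Vpow_eq_span)
  then have "finite B"
    using pm.independent_span_bound[OF _ B(2)] finite_words by blast
  moreover have "pm.span B = U"
    using B pm.span_minimal[OF B(1) assms(1)] by blast
  ultimately show ?thesis using B that by blast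
qed

lemma dim_Vpow: "pm.dim (Vpow m n) = m ^ n"
proof -
  have inj: "inj_on word_vec A" for A
    by (auto simp: inj_on_def word_vec_def dest!: arg_cong[where f = Poly_Mapping.keys])
  have "pm.independent (word_vec ` words m n)"
  proof (rule pm.independent_if_scalars_zero)
    show "finite (word_vec ` words m n)" by (simp add: finite_words)
    fix c x
    assume 0: "(\<Sum>x\<in>word_vec ` words m n. smul (c x) x) = 0" and x: "x \<in> word_vec ` words m n"
    then obtain w where w: "w \<in> words m n" "x = word_vec w" by auto
    have "0 = Poly_Mapping.lookup (\<Sum>x\<in>word_vec ` words m n. smul (c x) x) w"
      by (simp add: 0)
    also have "\<dots> = (\<Sum>v\<in>words m n. if v = w then c (word_vec v) else 0)"
      unfolding sum.reindex[OF inj] lookup_sum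
      by (intro sum.cong) (auto simp: word_vec_def lookup_single)
    also have "\<dots> = c x" using w finite_words by simp
    finally show "c x = 0" by simp
  qed
  moreover have "pm.span (word_vec ` words m n) = pm.span (Vpow m n)"
    by (simp only: Vpow_eq_span pm.span_span)
  ultimately have "pm.dim (Vpow m n) = card (word_vec ` words m n)"
    using pm.dim_eq_card by blast
  then show ?thesis by (simp add: card_image[OF inj] card_words)
qed

text \<open>Degree \<open>n\<close> of (1 + q)^m H(q) = 1 / (1 - m q), with H the Hilbert series of
  B(V): T(V) is a free left B(V)-module on the decreasing words.\<close>

lemma dim_ker_sum:
  "(\<Sum>j\<le>n. (m choose j) * pm.dim (ker\<sigma> m (n - j))) = m ^ n"
proof -
  let ?J = "{S. S \<subseteq> {1..m} \<and> card S \<le> n}"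
  have J: "finite ?J" by (rule finite_subset[of _ "Pow {1..m}"]) auto
  have "\<exists>B. finite B \<and> pm.independent B \<and> pm.span B = ker\<sigma> m k \<and> card B = pm.dim (ker\<sigma> m k)" for k
    by (metis basis_of_Vpow_subspace[OF subspace_ker, of m k m k] ker_Vpow subsetI)
  then obtain B where B: "\<And>k. finite (B k) \<and> pm.independent (B k) \<and> pm.span (B k) = ker\<sigma> m k
      \<and> card (B k) = pm.dim (ker\<sigma> m k)" by metis
  have "pm.dim (Vpow m n) = (\<Sum>S\<in>?J. card (B (n - card S)))"
  proof (rule dim_joint_injective[OF J, where f = "\<lambda>S k. k * decr_vec S"])
    show "Vpow m n = pm.span (\<Union>S\<in>?J. (\<lambda>k. k * decr_vec S) ` pm.span (B (n - card S)))"
    proof (intro antisym subsetI)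
      fix x assume "x \<in> Vpow m n"
      moreover have "(\<Union>S\<in>?J. (\<lambda>k. k * decr_vec S) ` pm.span (B (n - card S)))
          = {k * decr_vec S |k S. S \<subseteq> {1..m} \<and> card S \<le> n \<and> k \<in> ker\<sigma> m (n - card S)}"
        using B by auto
      ultimately show "x \<in> pm.span (\<Union>S\<in>?J. (\<lambda>k. k * decr_vec S) ` pm.span (B (n - card S)))"
        using Vpow_ker_decr by simp
    next
      have *: "k * decr_vec S \<in> Vpow m n" if "S \<in> ?J" "k \<in> ker\<sigma> m (n - card S)" for k S
        using Vpow_mult[OF ker_Vpow[OF that(2)] decr_vec_in_Vpow[of S]] that(1) by auto
      have "(\<Union>S\<in>?J. (\<lambda>k. k * decr_vec S) ` pm.span (B (n - card S))) \<subseteq> Vpow m n"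
        using B * by (auto simp del: One_nat_def)
      then show "x \<in> Vpow m n"
        if "x \<in> pm.span (\<Union>S\<in>?J. (\<lambda>k. k * decr_vec S) ` pm.span (B (n - card S)))" for x
        using that pm.span_minimal[OF _ subspace_Vpow] by blast
    qed
    fix a S
    assume a: "\<And>S. S \<in> ?J \<Longrightarrow> a S \<in> pm.span (B (n - card S))"
      and 0: "(\<Sum>S\<in>?J. a S * decr_vec S) = 0" and S: "S \<in> ?J"
    \<comment> \<open>Extension by zero to all subsets, as \<open>decr_vec_independent\<close>
      expects.\<close>
    let ?a = "\<lambda>S. if card S \<le> n then a S else 0"
    have "(\<Sum>S\<in>Pow {1..m}. ?a S * decr_vec S) = (\<Sum>S\<in>?J. a S * decr_vec S)"
      by (rule sum.mono_neutral_cong_right) auto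
    then have sum: "(\<Sum>S\<in>Pow {1..m}. ?a S * decr_vec S) = 0" using 0 by simp
    have ker: "?a T \<in> ker\<sigma> m (n - card T)" if "T \<subseteq> {1..m}" "card T \<le> n" for T
      using a[of T] B that by simp
    have "?a S = 0"
      by (rule decr_vec_independent[where a = ?a, OF ker _ sum]) (use S in simp_all)
    then show "a S = 0" using S by simp
  qed (use B in \<open>auto intro: lin_mult_right\<close>)
  also have "\<dots> = (\<Sum>S\<in>?J. pm.dim (ker\<sigma> m (n - card S)))" by (simp add: B)
  also have "\<dots> = (\<Sum>j\<le>n. \<Sum>S | S \<in> ?J \<and> card S = j. pm.dim (ker\<sigma> m (n - card S)))"
    using J by (intro sum.group[symmetric]) auto
  also have "\<dots> = (\<Sum>j\<le>n. (m choose j) * pm.dim (ker\<sigma> m (n - j)))"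
  proof (intro sum.cong refl)
    fix j assume "j \<in> {..n}"
    then have "{S. S \<in> ?J \<and> card S = j} = {S. S \<subseteq> {1..m} \<and> card S = j}" by auto
    then show "(\<Sum>S | S \<in> ?J \<and> card S = j. pm.dim (ker\<sigma> m (n - card S)))
        = (m choose j) * pm.dim (ker\<sigma> m (n - j))"
      using n_subsets[of "{1..m}" j] by simp
  qed
  finally show ?thesis by (simp add: dim_Vpow)
qed

subsection \<open>Homogeneous components\<close>

definition hcomp :: "nat \<Rightarrow> tens \<Rightarrow> tens"
  where "hcomp n p = Poly_Mapping.Abs_poly_mapping (\<lambda>w. if length w = n then Poly_Mapping.lookup p w else 0)"

lemma lookup_hcomp: "Poly_Mapping.lookup (hcomp n p) w = (if length w = n then Poly_Mapping.lookup p w else 0)"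
proof -
  have "finite {w. (if length w = n then Poly_Mapping.lookup p w else 0) \<noteq> 0}"
    by (rule finite_subset[of _ "Poly_Mapping.keys p"]) (auto simp: in_keys_iff)
  then show ?thesis by (simp only: hcomp_def lookup_Abs_poly_mapping)
qed

lemma lin_hcomp: "lin (hcomp n)"
  by (auto intro!: linI poly_mapping_eqI simp: lookup_hcomp lookup_add)

lemma hcomp_word_vec: "hcomp n (word_vec w) = (if length w = n then word_vec w else 0)"
  by (auto intro!: poly_mapping_eqI simp: lookup_hcomp word_vec_def lookup_single when_def)

lemma hcomp_zero_imp: "(\<And>n. hcomp n p = 0) \<Longrightarrow> p = 0"
  by (intro poly_mapping_eqI) (metis lookup_hcomp lookup_zero)

lemma hcomp_mult:
  assumes "x \<in> Vpow m i"
  shows "hcomp n (p * x) = (if i \<le> n then hcomp (n - i) p * x else 0)"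
proof (rule Vpow_eqI[OF lin_comp[OF lin_hcomp lin_mult_left] _ assms])
  show "lin (\<lambda>x::tens. if i \<le> n then hcomp (n - i) p * x else 0)"
    by (cases "i \<le> n") (auto intro: lin_mult_left linI)
  fix v assume v: "length v = i" "set v \<subseteq> {1..m}"
  show "hcomp n (p * word_vec v) = (if i \<le> n then hcomp (n - i) p * word_vec v else 0)"
  proof (rule tens_eqI[where f = "\<lambda>p. hcomp n (p * word_vec v)"])
    show "lin (\<lambda>p. hcomp n (p * word_vec v))" by (rule lin_comp[OF lin_hcomp lin_mult_right])
    show "lin (\<lambda>p::tens. if i \<le> n then hcomp (n - i) p * word_vec v else 0)"
      by (cases "i \<le> n") (auto intro: lin_comp[OF lin_mult_right lin_hcomp] linI)
    fix w :: "nat list"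
    have "(length w + i = n) = (i \<le> n \<and> length w = n - i)" by auto
    then show "hcomp n (word_vec w * word_vec v) = (if i \<le> n then hcomp (n - i) (word_vec w) * word_vec v else 0)"
      using v by (simp add: hcomp_word_vec flip: word_vec_append)
  qed
qed

text \<open>The whole algebra T(V), with inhomogeneous elements included.\<close>

definition Tens :: "nat \<Rightarrow> tens set"
  where "Tens m = {p. \<forall>w\<in>Poly_Mapping.keys p. set w \<subseteq> {1..m}}"

lemma hcomp_in_Vpow: "p \<in> Tens m \<Longrightarrow> hcomp n p \<in> Vpow m n"
  by (auto simp: Tens_def Vpow_def in_keys_iff lookup_hcomp split: if_splits)

lemma Tens_eq_span: "Tens m = pm.span (word_vec ` {w. set w \<subseteq> {1..m}})"
  unfolding word_vec_def[abs_def] span_single by (auto simp: Tens_def)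

lemma BV_subset_Tens: "BV m \<subseteq> Tens m"
proof -
  have "pm.subspace (Tens m)" by (simp add: Tens_eq_span)
  moreover have "ker\<sigma> m n \<subseteq> Tens m" for n
    using ker_Vpow[of _ m n] unfolding Tens_def Vpow_def by blast
  ultimately show ?thesis
    unfolding BV_def by (intro pm.span_minimal) auto
qed

lemma ker_subset_BV: "ker\<sigma> m n \<subseteq> BV m"
  unfolding BV_def using pm.span_superset by blast

lemma subalgebra_BV: "is_subalgebra (BV m)"
proof -
  have "p * q \<in> BV m" if "p \<in> BV m" "q \<in> BV m" for p q
    unfolding BV_def
  proof (rule lin_span_subset[OF lin_mult_right pm.subspace_span _ that(1)[unfolded BV_def]])
    fix x assume "x \<in> (\<Union>n. ker\<sigma> m n)"
    then obtain a where a: "x \<in> ker\<sigma> m a" by auto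
    show "x * q \<in> pm.span (\<Union>n. ker\<sigma> m n)"
    proof (rule lin_span_subset[OF lin_mult_left pm.subspace_span _ that(2)[unfolded BV_def]])
      fix y assume "y \<in> (\<Union>n. ker\<sigma> m n)"
      then obtain b where "y \<in> ker\<sigma> m b" by auto
      then have "x * y \<in> ker\<sigma> m (a + b)" using a by blast
      then show "x * y \<in> pm.span (\<Union>n. ker\<sigma> m n)" by (intro pm.span_base) blast
    qed
  qed
  then show ?thesis
    using subsetD[OF ker_subset_BV one_in_ker[of m]] by (simp add: is_subalgebra_def BV_def)
qed

subsection \<open>Left independence of the generators\<close>

text \<open>Bases are fixed in all degrees from 2 on: that nothing is left above
  \<open>m + 1\<close> follows only later, from the Hilbert series (\<open>B_empty\<close>).\<close>

locale choice_bases =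
  fixes m :: nat and W B :: "nat \<Rightarrow> tens set"
  assumes choice: "is_choice m W"
    and basis: "2 \<le> n \<Longrightarrow> is_basis (B n) (W n)"
begin

lemma W_1: "W (Suc 0) = {0}"
  using choice by (simp add: is_choice_def)

lemma W_facts:
  assumes "2 \<le> n"
  shows W_ker: "W n \<subseteq> ker\<sigma> m n"
    and W_direct: "is_direct_sum (pm.span (\<Union>i\<in>{1..n - 1}. tensor_sub (ker\<sigma> m (n - i)) (W i))) (W n)
        (ker\<sigma> m n)"
  using choice assms unfolding is_choice_def by blast+

lemma B_facts:
  assumes "2 \<le> n"
  shows finite_B: "finite (B n)" and independent_B: "pm.independent (B n)"
    and span_B: "pm.span (B n) = W n" and card_B: "card (B n) = pm.dim (W n)"
    and B_ker: "B n \<subseteq> ker\<sigma> m n"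
proof -
  show *: "pm.independent (B n)" "pm.span (B n) = W n"
    using basis[OF assms] by (auto simp: is_basis_def)
  then show "card (B n) = pm.dim (W n)"
    using pm.dim_span_eq_card_independent by metis
  show ker: "B n \<subseteq> ker\<sigma> m n"
    using W_ker[OF assms] pm.span_superset[of "B n"] *(2) by blast
  have "B n \<subseteq> pm.span (word_vec ` words m n)"
    using ker ker_Vpow by (auto simp flip: Vpow_eq_span)
  then show "finite (B n)"
    using pm.independent_span_bound[OF _ *(1)] finite_words by blast
qed

text \<open>
  Cancelling a word of maximal length from the left-hand coefficients expresses an element of
  \<^term>\<open>W N\<close> through generators of smaller degree; applying \<open>\<sigma>\<close> to that expression shows that its
  coefficients lie in the kernels, against the choice of \<^term>\<open>W N\<close> as a complement.
\<close>

lemma B_left_independent_hom: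
  assumes "N \<le> n"
    and "\<And>i x. i \<in> {2..N} \<Longrightarrow> x \<in> B i \<Longrightarrow> a i x \<in> Vpow m (n - i)"
    and "(\<Sum>i\<in>{2..N}. \<Sum>x\<in>B i. a i x * x) = 0"
    and "i \<in> {2..N}" "x \<in> B i"
  shows "a i x = 0"
  using assms
proof (induction N arbitrary: n a i x)
  case (Suc N)
  show ?case
  proof (cases "2 \<le> Suc N")
    case False
    then show ?thesis using Suc.prems(4) by simp
  next
    case True
    let ?M = "Suc N"
    have split: "(\<Sum>i\<in>{2..?M}. f i) = (\<Sum>i\<in>{2..N}. f i) + f ?M" for f :: "nat \<Rightarrow> tens"
      using True by (simp add: sum.nat_ivl_Suc')
    have top: "a ?M x0 = 0" if x0: "x0 \<in> B ?M" for x0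
    proof (rule ccontr)
      assume "a ?M x0 \<noteq> 0"
      \<comment> \<open>A word of the top coefficient has its full degree \<open>n - ?M\<close>;
        cancelling it turns all coefficients of \<open>B ?M\<close> into scalars and brings the
        relation to degree \<open>?M\<close>.\<close>
      then obtain u where u: "Poly_Mapping.lookup (a ?M x0) u \<noteq> 0"
        by (metis lookup_zero poly_mapping_eqI)
      have len: "length u = n - ?M"
        using Suc.prems(2)[of ?M x0] x0 u True by (auto simp: Vpow_def in_keys_iff)
      define b where "b i x = lquot u (a i x)" for i x
      define c where "c x = Poly_Mapping.lookup (a ?M x) u" for x
      define w where "w = (\<Sum>x\<in>B ?M. smul (c x) x)"
      have b_in: "b i x \<in> Vpow m (?M - i)" if "i \<in> {2..?M}" "x \<in> B i" for i x
        unfolding b_def using Suc.prems(1) Suc.prems(2)[OF that] that len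
        by (intro lquot_in_Vpow) simp
      have "b ?M x = smul (c x) 1" if "x \<in> B ?M" for x
      proof -
        have "b ?M x \<in> Vpow m 0" using b_in[of ?M x] \<open>x \<in> B ?M\<close> True by simp
        then obtain d where d: "b ?M x = smul d 1" by (auto simp: Vpow_0)
        have "Poly_Mapping.lookup (b ?M x) [] = c x" by (simp add: b_def lookup_lquot c_def)
        then show ?thesis using d by (simp add: lookup_one zero_list_def)
      qed
      then have w: "w = (\<Sum>x\<in>B ?M. b ?M x * x)"
        unfolding w_def by (intro sum.cong refl) (simp add: smul_mult_left)
      have "0 = lquot u (\<Sum>i\<in>{2..?M}. \<Sum>x\<in>B i. a i x * x)"
        by (simp only: Suc.prems(3) lin_zero[OF lin_lquot])
      also have "\<dots> = (\<Sum>i\<in>{2..?M}. \<Sum>x\<in>B i. b i x * x)"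
        unfolding lin_sum[OF lin_lquot] b_def
        by (intro sum.cong refl lquot_mult[OF Suc.prems(2)]) (use len in auto)
      finally have rel: "(\<Sum>i\<in>{2..N}. \<Sum>x\<in>B i. b i x * x) + w = 0"
        unfolding w split by simp
      have w_W: "w \<in> W ?M"
        unfolding w_def span_B[OF True, symmetric] by (intro pm.span_sum pm.span_scale pm.span_base)
      \<comment> \<open>The second Leibniz term vanishes as \<open>x\<close> is in the kernel, so
        \<sigma> reaches the coefficients alone.\<close>
      have ker: "\<sigma> ?M (b i x * x) = \<sigma> (?M - i) (b i x) * x" if "i \<in> {2..N}" "x \<in> B i" for i x
      proof -
        have "x \<in> ker\<sigma> m i" using B_ker[of i] that by auto
        then show ?thesis
          using sigma_Leibniz[OF b_in[of i x], of i x] that by (simp add: ker\<sigma>_def lin_zero[OF lin_D])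
      qed
      have "0 = \<sigma> ?M ((\<Sum>i\<in>{2..N}. \<Sum>x\<in>B i. b i x * x) + w)"
        by (simp only: rel lin_zero[OF lin_sigma])
      also have "\<dots> = (\<Sum>i\<in>{2..N}. \<Sum>x\<in>B i. \<sigma> ?M (b i x * x))"
        using W_ker[OF True] w_W by (auto simp: linD[OF lin_sigma] lin_sum[OF lin_sigma] ker\<sigma>_def)
      also have "\<dots> = (\<Sum>i\<in>{2..N}. \<Sum>x\<in>B i. \<sigma> (?M - i) (b i x) * x)"
        by (intro sum.cong refl ker)
      finally have sum0: "(\<Sum>i\<in>{2..N}. \<Sum>x\<in>B i. \<sigma> (?M - i) (b i x) * x) = 0" by simp
      \<comment> \<open>Applying \<sigma> has removed \<open>w\<close>, which leaves a relation
        among generators of degree at most \<open>N\<close>.\<close>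
      have "\<sigma> (?M - i) (b i x) = 0" if "i \<in> {2..N}" "x \<in> B i" for i x
      proof (rule Suc.IH[where n = ?M and a = "\<lambda>i x. \<sigma> (?M - i) (b i x)", OF _ _ sum0 that])
        fix i x assume "i \<in> {2..N}" "x \<in> B i"
        then show "\<sigma> (?M - i) (b i x) \<in> Vpow m (?M - i)" by (intro sigma_in_Vpow b_in) auto
      qed simp
      then have b_ker: "b i x \<in> ker\<sigma> m (?M - i)" if "i \<in> {2..N}" "x \<in> B i" for i x
        using that b_in[of i x] by (simp add: ker\<sigma>_def)
      let ?U = "pm.span (\<Union>i\<in>{1..?M - 1}. tensor_sub (ker\<sigma> m (?M - i)) (W i))"
      have "b i x * x \<in> ?U" if "i \<in> {2..N}" "x \<in> B i" for i x
      proof -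
        have "x \<in> W i" using span_B[of i] that pm.span_base by auto
        then have "b i x * x \<in> tensor_sub (ker\<sigma> m (?M - i)) (W i)"
          unfolding tensor_sub_def using b_ker[OF that] by (intro pm.span_base) blast
        then show ?thesis using that by (intro pm.span_base) auto
      qed
      then have "(\<Sum>i\<in>{2..N}. \<Sum>x\<in>B i. b i x * x) \<in> ?U"
        by (intro pm.span_sum)
      moreover have "w = - (\<Sum>i\<in>{2..N}. \<Sum>x\<in>B i. b i x * x)"
        using rel by (simp add: eq_neg_iff_add_eq_0 add.commute)
      ultimately have "w \<in> ?U" by (simp only: pm.span_neg)
      \<comment> \<open>\<open>w\<close> is decomposable and lies in the chosen complement of the
        decomposables.\<close>
      then have "w = 0" using W_direct[OF True] w_W unfolding is_direct_sum_def by blast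
      then have "c x0 = 0"
        using independent_sum_zero[OF finite_B[OF True] independent_B[OF True], of c x0] x0
        by (simp add: w_def)
      then show False using u by (simp add: c_def)
    qed
    show ?thesis
    proof (cases "i = ?M")
      case True
      then show ?thesis using top Suc.prems(5) by simp
    next
      case False
      have "(\<Sum>i\<in>{2..N}. \<Sum>x\<in>B i. a i x * x) = 0"
        using Suc.prems(3) top unfolding split by simp
      then show ?thesis
        using Suc.prems(1,4,5) False
        by (intro Suc.IH[where n = n and a = a] Suc.prems(2)) auto
    qed
  qed
qed simp

text \<open>Reduction to \<open>B_left_independent_hom\<close>: the generators are homogeneous, so a
  relation splits into its homogeneous components.\<close>

lemma B_left_independent:
  assumes a: "\<And>i x. i \<in> {2..N} \<Longrightarrow> x \<in> B i \<Longrightarrow> a i x \<in> Tens m"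
    and sum: "smul c 1 + (\<Sum>i\<in>{2..N}. \<Sum>x\<in>B i. a i x * x) = 0"
  shows "i \<in> {2..N} \<Longrightarrow> x \<in> B i \<Longrightarrow> a i x = 0" and "c = 0"
proof -
  show zero: "a i x = 0" if ix: "i \<in> {2..N}" "x \<in> B i" for i x
  proof (rule hcomp_zero_imp)
    fix k
    \<comment> \<open>Component \<open>k\<close> of \<open>a i x\<close> contributes in degree
      \<open>k + i\<close>, which is positive, so the constant does not interfere.\<close>
    let ?n = "k + i"
    let ?b = "\<lambda>i x. hcomp (?n - i) (a i x)"
    have x: "x \<in> Vpow m i" if "i \<in> {2..N}" "x \<in> B i" for i x
      using B_ker[of i] ker_Vpow that by auto
    have "0 = hcomp ?n (smul c 1 + (\<Sum>i\<in>{2..N}. \<Sum>x\<in>B i. a i x * x))"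
      by (simp only: sum lin_zero[OF lin_hcomp])
    also have "\<dots> = (\<Sum>i\<in>{2..N}. \<Sum>x\<in>B i. hcomp ?n (a i x * x))"
      using hcomp_word_vec[of ?n "[]"] ix by (simp add: linD[OF lin_hcomp] lin_sum[OF lin_hcomp])
    also have "\<dots> = (\<Sum>i\<in>{2..N}. if i \<le> ?n then \<Sum>x\<in>B i. ?b i x * x else 0)"
    proof (intro sum.cong refl)
      fix j assume j: "j \<in> {2..N}"
      have "(\<Sum>x\<in>B j. hcomp ?n (a j x * x)) = (\<Sum>x\<in>B j. if j \<le> ?n then ?b j x * x else 0)"
        by (intro sum.cong refl hcomp_mult[OF x[OF j]])
      then show "(\<Sum>x\<in>B j. hcomp ?n (a j x * x)) = (if j \<le> ?n then \<Sum>x\<in>B j. ?b j x * x else 0)"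
        by (cases "j \<le> ?n") simp_all
    qed
    \<comment> \<open>Generators of degree above \<open>?n\<close> drop out; this gives the bound
      that \<open>B_left_independent_hom\<close> asks for.\<close>
    also have "\<dots> = (\<Sum>i\<in>{2..min N ?n}. \<Sum>x\<in>B i. ?b i x * x)"
      by (rule sum.mono_neutral_cong_right) auto
    finally have "(\<Sum>i\<in>{2..min N ?n}. \<Sum>x\<in>B i. ?b i x * x) = 0" by simp
    then have "?b i x = 0"
      using ix a by (intro B_left_independent_hom[of "min N ?n" ?n ?b i x] hcomp_in_Vpow) auto
    then show "hcomp k (a i x) = 0" by simp
  qed
  have "smul c (1::tens) = 0" using sum zero by simp
  then show "c = 0" by simp
qed

text \<open>The defining decomposition with complements replaced by their bases: \<open>W n\<close>
  enters with coefficients from \<open>ker\<sigma> m 0\<close>, and the summand for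
  \<open>i = 1\<close> is zero.\<close>

lemma ker_span_B:
  assumes "0 < n"
  shows "ker\<sigma> m n = pm.span {k * x |k x i. i \<in> {2..n} \<and> x \<in> B i \<and> k \<in> ker\<sigma> m (n - i)}"
    (is "_ = pm.span ?G")
proof
  have "?G \<subseteq> ker\<sigma> m n"
  proof clarify
    fix k x i assume *: "i \<in> {2..n}" "x \<in> B i" "k \<in> ker\<sigma> m (n - i)"
    then have "x \<in> ker\<sigma> m i" using B_ker[of i] by auto
    then show "k * x \<in> ker\<sigma> m n" using ker_mult[OF *(3), of x i] * by simp
  qed
  then show "pm.span ?G \<subseteq> ker\<sigma> m n"
    by (rule pm.span_minimal[OF _ subspace_ker])
  have W: "k * y \<in> pm.span ?G" if "i \<in> {2..n}" "y \<in> W i" "k \<in> ker\<sigma> m (n - i)" for i y k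
  proof (rule lin_span_subset[OF lin_mult_left pm.subspace_span])
    show "y \<in> pm.span (B i)" using that span_B by auto
    fix x assume "x \<in> B i"
    then show "k * x \<in> pm.span ?G" using that by (intro pm.span_base) blast
  qed
  show "ker\<sigma> m n \<subseteq> pm.span ?G"
  proof (cases "2 \<le> n")
    case False
    then have "n = Suc 0" using assms by simp
    then show ?thesis by (simp add: ker_1 pm.span_zero)
  next
    case True
    have "tensor_sub (ker\<sigma> m (n - i)) (W i) \<subseteq> pm.span ?G" if i: "i \<in> {1..n - 1}" for i
      unfolding tensor_sub_def
    proof (intro pm.span_minimal pm.subspace_span, clarify)
      fix k y assume ky: "k \<in> ker\<sigma> m (n - i)" "y \<in> W i"
      show "k * y \<in> pm.span ?G"
      proof (cases "i = 1")
        case True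
        then show ?thesis using ky W_1 by (simp add: pm.span_zero)
      next
        case False
        then show ?thesis using i ky by (intro W[of i]) auto
      qed
    qed
    then have U: "pm.span (\<Union>i\<in>{1..n - 1}. tensor_sub (ker\<sigma> m (n - i)) (W i)) \<subseteq> pm.span ?G"
      by (intro pm.span_minimal pm.subspace_span) blast
    have Wn: "W n \<subseteq> pm.span ?G"
      using W[of n _ 1] True one_in_ker by auto
    show ?thesis
    proof
      fix z assume "z \<in> ker\<sigma> m n"
      then obtain u u' where u: "u \<in> pm.span (\<Union>i\<in>{1..n - 1}. tensor_sub (ker\<sigma> m (n - i)) (W i))"
        and u': "u' \<in> W n" and z: "z = u + u'"
        using W_direct[OF True] unfolding is_direct_sum_def by blast
      show "z \<in> pm.span ?G"
        unfolding z by (rule pm.span_add[OF subsetD[OF U u] subsetD[OF Wn u']])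
    qed
  qed
qed

text \<open>The expansion from \<open>ker_span_B\<close> is unique by
  \<open>B_left_independent_hom\<close>. For series this reads H = 1 + B H, with B counting the
  generators.\<close>

lemma dim_ker_recursion:
  assumes "0 < n"
  shows "pm.dim (ker\<sigma> m n) = (\<Sum>i\<in>{2..n}. pm.dim (W i) * pm.dim (ker\<sigma> m (n - i)))"
proof -
  have "\<exists>C. finite C \<and> pm.independent C \<and> pm.span C = ker\<sigma> m k \<and> card C = pm.dim (ker\<sigma> m k)" for k
    by (metis basis_of_Vpow_subspace[OF subspace_ker, of m k m k] ker_Vpow subsetI)
  then obtain C where C: "\<And>k. finite (C k) \<and> pm.independent (C k) \<and> pm.span (C k) = ker\<sigma> m k
      \<and> card (C k) = pm.dim (ker\<sigma> m k)" by metis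
  let ?J = "Sigma {2..n} B"
  have "pm.dim (ker\<sigma> m n) = (\<Sum>j\<in>?J. card (C (n - fst j)))"
  proof (rule dim_joint_injective[where f = "\<lambda>j k. k * snd j"])
    show "finite ?J" using finite_B by auto
    have "(\<Union>j\<in>?J. (\<lambda>k. k * snd j) ` pm.span (C (n - fst j)))
        = {k * x |k x i. i \<in> {2..n} \<and> x \<in> B i \<and> k \<in> ker\<sigma> m (n - i)}"
      using C by force
    then show "ker\<sigma> m n = pm.span (\<Union>j\<in>?J. (\<lambda>k. k * snd j) ` pm.span (C (n - fst j)))"
      using ker_span_B[OF assms] by simp
    fix a j
    assume a: "\<And>j. j \<in> ?J \<Longrightarrow> a j \<in> pm.span (C (n - fst j))"
      and 0: "(\<Sum>j\<in>?J. a j * snd j) = 0" and j: "j \<in> ?J"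
    have "(\<Sum>i\<in>{2..n}. \<Sum>x\<in>B i. a (i, x) * x) = 0"
      using 0 finite_B by (subst sum.Sigma) (auto simp: case_prod_unfold)
    then have "a (i, x) = 0" if "i \<in> {2..n}" "x \<in> B i" for i x
      using that a C ker_Vpow
      by (intro B_left_independent_hom[of n n "\<lambda>i x. a (i, x)"]) fastforce+
    then show "a j = 0" using j by auto
  qed (use C in \<open>auto intro: lin_mult_right\<close>)
  also have "\<dots> = (\<Sum>(i, x)\<in>?J. pm.dim (ker\<sigma> m (n - i)))"
    by (intro sum.cong) (auto simp: C)
  also have "\<dots> = (\<Sum>i\<in>{2..n}. \<Sum>x\<in>B i. pm.dim (ker\<sigma> m (n - i)))"
    using finite_B by (subst sum.Sigma) auto
  also have "\<dots> = (\<Sum>i\<in>{2..n}. pm.dim (W i) * pm.dim (ker\<sigma> m (n - i)))"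
    by (intro sum.cong refl) (simp add: card_B)
  finally show ?thesis .
qed

end

lemma lin_module_hom: "lin f \<Longrightarrow> module_hom smul smul f"
  by (simp add: module_hom_iff_linear)

lemma one_eq_single_Nil: "1 = Poly_Mapping.single ([] :: 'a list) (1 :: 'k::zero_neq_one)"
  by (metis single_one zero_list_def)

subsection \<open>Hilbert series\<close>

context choice_bases
begin

text \<open>Three identities are combined: H (1 - B) = 1, (1 + q)^m H = T and (1 - m q) T = 1, where
  H, B and T are the series of the kernels, of the generators and of T(V).\<close>

lemma generators_fps:
  "1 - Abs_fps (\<lambda>n. if 2 \<le> n then int (pm.dim (W n)) else 0)
    = fps_of_poly ([:1, - int m:] * [:1, 1:] ^ m)"
  (is "1 - ?B = fps_of_poly ?P")
proof -
  let ?H = "Abs_fps (\<lambda>n. int (pm.dim (ker\<sigma> m n)))"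
  let ?T = "Abs_fps (\<lambda>n. int m ^ n)"
  let ?C = "fps_of_poly ([:1, 1:] ^ m :: int poly)"
  let ?L = "fps_of_poly [:1, - int m:]"
  have HB: "?H * (1 - ?B) = 1"
  proof (rule fps_ext)
    fix n
    show "(?H * (1 - ?B)) $ n = 1 $ n"
    proof (cases "n = 0")
      case True
      then show ?thesis by (simp add: ker_0 dim_Vpow)
    next
      case False
      have "(?B * ?H) $ n = (\<Sum>i\<in>{2..n}. int (pm.dim (W i)) * int (pm.dim (ker\<sigma> m (n - i))))"
        unfolding fps_mult_nth
        by (rule sum.mono_neutral_cong_right) auto
      also have "\<dots> = ?H $ n" using dim_ker_recursion[of n] False by simp
      finally show ?thesis using False by (simp add: right_diff_distrib mult.commute)
    qed
  qed
  have C: "coeff ([:1, 1:] ^ m :: int poly) j = int (m choose j)" for j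
  proof (cases "j \<le> m")
    case True
    then show ?thesis by (simp add: coeff_linear_poly_power)
  next
    case False
    then show ?thesis by (simp add: coeff_eq_0 degree_power_eq)
  qed
  have "?C * ?H = ?T"
  proof (rule fps_ext)
    fix n
    have "(?C * ?H) $ n = (\<Sum>j\<le>n. int (m choose j) * int (pm.dim (ker\<sigma> m (n - j))))"
      by (simp add: fps_mult_nth C atMost_atLeast0)
    also have "\<dots> = int (m ^ n)" unfolding dim_ker_sum[symmetric] by simp
    finally show "(?C * ?H) $ n = ?T $ n" by simp
  qed
  moreover have "?L * ?T = 1"
  proof (rule fps_ext)
    fix n
    have "?L * ?T = ?T - fps_const (int m) * (fps_X * ?T)"
      by (simp add: fps_of_poly_pCons left_diff_distrib mult.assoc flip: fps_const_neg)
    then show "(?L * ?T) $ n = 1 $ n" by (cases n) simp_all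
  qed
  ultimately have "?L * (?C * ?H) = 1" by simp
  then have "1 - ?B = (?L * (?C * ?H)) * (1 - ?B)" by simp
  also have "\<dots> = ?L * ?C * (?H * (1 - ?B))" by (simp only: mult.assoc)
  finally have "1 - ?B = ?L * ?C" by (simp only: HB mult_1_right)
  then show ?thesis by (simp only: fps_of_poly_mult)
qed

lemma dim_W: "int (pm.dim (W n)) = - coeff ([:1, - int m:] * [:1, 1:] ^ m) n" if "2 \<le> n"
  using arg_cong[OF generators_fps, of "\<lambda>f. f $ n"] that by simp

lemma generators_poly:
  "(1 - (\<Sum>i = 2..m + 1. monom (int (pm.dim (W i))) i) :: int poly) = [:1, - int m:] * [:1, 1:] ^ m"
  (is "?Q = ?P")
proof (rule poly_eqI)
  fix n
  have sum: "coeff (\<Sum>i = 2..m + 1. monom (int (pm.dim (W i))) i) n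
      = (if n \<in> {2..m + 1} then int (pm.dim (W n)) else 0)"
    by (simp add: coeff_sum)
  have "degree ?P \<le> m + 1"
    by (rule order.trans[OF degree_mult_le]) (auto simp: degree_power_eq)
  then have "coeff ?P n = 0" if "m + 1 < n" using that by (intro coeff_eq_0) simp
  moreover have "coeff ?P n = (1 - Abs_fps (\<lambda>n. if 2 \<le> n then int (pm.dim (W n)) else 0)) $ n"
    unfolding generators_fps by simp
  ultimately show "coeff ?Q n = coeff ?P n"
    unfolding coeff_diff sum by auto
qed

text \<open>The polynomial (1 - m q)(1 + q)^m has degree at most \<open>m + 1\<close>, so the
  complements vanish in higher degrees.\<close>

lemma B_empty:
  assumes "m + 1 < n" "1 \<le> m"
  shows "B n = {}"
proof -
  have "degree ([:1, - int m:] * [:1, 1:] ^ m) \<le> m + 1"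
    by (rule order.trans[OF degree_mult_le]) (auto simp: degree_power_eq)
  then have "pm.dim (W n) = 0"
    using dim_W[of n] assms coeff_eq_0[of "[:1, - int m:] * [:1, 1:] ^ m" n] by simp
  then show ?thesis using card_B[of n] finite_B[of n] assms by simp
qed

subsection \<open>Free generation\<close>

abbreviation eval_words :: "(tens list \<Rightarrow>\<^sub>0 K) \<Rightarrow> tens"
  where "eval_words \<equiv> lin_ext prod_list"

abbreviation gens :: "tens set"
  where "gens \<equiv> (\<Union>i\<in>{2..m + 1}. B i)"

lemma free_algebra_span:
  "free_algebra X = pm.span ((\<lambda>w. Poly_Mapping.single w (1::'k::field)) ` {w. set w \<subseteq> X})"
  unfolding span_single by (auto simp: free_algebra_def)

lemma subspace_free_algebra: "pm.subspace (free_algebra X)"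
  by (simp add: free_algebra_span)

lemma finite_gens: "finite gens"
  using finite_B by auto

text \<open>The bases are disjoint: an element homogeneous of two degrees is zero, and zero is in no
  basis.\<close>

lemma sum_gens: "(\<Sum>x\<in>gens. f x) = (\<Sum>i\<in>{2..m + 1}. \<Sum>x\<in>B i. f x)"
proof (rule sum.UNION_disjoint)
  show "\<forall>i\<in>{2..m + 1}. \<forall>j\<in>{2..m + 1}. i \<noteq> j \<longrightarrow> B i \<inter> B j = {}"
  proof (intro ballI impI)
    fix i j assume ij: "i \<in> {2..m + 1}" "j \<in> {2..m + 1}" "i \<noteq> j"
    have "x = 0" if "x \<in> B i" "x \<in> B j" for x
    proof -
      have "x \<in> Vpow m i" "x \<in> Vpow m j"
        using that ij B_ker[of i] B_ker[of j] ker_Vpow by auto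
      then have "Poly_Mapping.keys x = {}" using ij(3) by (auto simp: Vpow_def)
      then show "x = 0" by simp
    qed
    moreover have "0 \<notin> B i" using independent_B[of i] ij pm.dependent_zero by auto
    ultimately show "B i \<inter> B j = {}" by blast
  qed
qed (use finite_B in auto)

lemma eval_words_mult_letter:
  "eval_words (p * Poly_Mapping.single [x] 1) = eval_words p * x"
  by (rule lin_eqI[OF lin_comp[OF lin_lin_ext lin_mult_right] lin_comp[OF lin_mult_right lin_lin_ext]])
    (simp add: mult_single lin_ext_single plus_list_def)

lemma rquot_single:
  "rquot x (Poly_Mapping.single w 1)
    = (if w \<noteq> [] \<and> last w = x then Poly_Mapping.single (butlast w) 1 else 0)"
  by (cases w rule: rev_cases) (auto intro!: poly_mapping_eqI simp: lookup_rquot lookup_single when_def)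

text \<open>Splitting by the last letter fits the left coefficients in
  \<open>B_left_independent\<close>.\<close>

lemma free_algebra_expand:
  assumes "p \<in> free_algebra X" "finite X"
  shows "p = smul (Poly_Mapping.lookup p []) 1 + (\<Sum>x\<in>X. rquot x p * Poly_Mapping.single [x] 1)"
proof (rule lin_eq_on_span[where f = "\<lambda>p. p"])
  show "p \<in> pm.span ((\<lambda>w. Poly_Mapping.single w 1) ` {w. set w \<subseteq> X})"
    using assms by (simp add: free_algebra_span)
  show "lin (\<lambda>p. smul (Poly_Mapping.lookup p []) 1
      + (\<Sum>x\<in>X. rquot x p * Poly_Mapping.single [x] (1::K)))"
    by (rule linI) (simp_all add: lookup_add pm.scale_left_distrib pm.scale_right_distrib
        linD[OF lin_rquot] distrib_right sum.distrib smul_mult_left pm.scale_sum_right)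
  fix p assume "p \<in> (\<lambda>w. Poly_Mapping.single w (1::K)) ` {w. set w \<subseteq> X}"
  then obtain w where w: "set w \<subseteq> X" "p = Poly_Mapping.single w 1" by auto
  show "p = smul (Poly_Mapping.lookup p []) 1 + (\<Sum>x\<in>X. rquot x p * Poly_Mapping.single [x] 1)"
  proof (cases w rule: rev_cases)
    case Nil
    then show ?thesis by (simp add: w rquot_single one_eq_single_Nil smul_def)
  next
    case (snoc v y)
    have "(\<Sum>x\<in>X. rquot x p * Poly_Mapping.single [x] 1) = (\<Sum>x\<in>X. if x = y then p else 0)"
      by (intro sum.cong) (auto simp: w snoc rquot_single mult_single plus_list_def)
    then show ?thesis
      using w snoc assms(2) by (simp add: lookup_single)
  qed
qed (auto intro: linI)

lemma gens_subset_BV: "gens \<subseteq> BV m"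
  using B_ker ker_subset_BV by fastforce

lemma eval_words_in_BV:
  assumes "p \<in> free_algebra gens"
  shows "eval_words p \<in> BV m"
proof (rule lin_span_subset[OF lin_lin_ext _ _ assms[unfolded free_algebra_span]])
  show "pm.subspace (BV m)" using subalgebra_BV by (simp add: is_subalgebra_def)
  fix x assume "x \<in> (\<lambda>w. Poly_Mapping.single w (1::K)) ` {w. set w \<subseteq> gens}"
  then obtain w where w: "set w \<subseteq> gens" "x = Poly_Mapping.single w 1" by auto
  have "prod_list w \<in> BV m"
    using w(1)
  proof (induction w)
    case Nil
    then show ?case using subalgebra_BV by (simp add: is_subalgebra_def)
  next
    case (Cons x w)
    then have "x \<in> BV m" "prod_list w \<in> BV m" using gens_subset_BV by auto
    then show ?case using subalgebra_BV by (simp add: is_subalgebra_def)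
  qed
  then show "eval_words x \<in> BV m" by (simp add: w lin_ext_single)
qed

text \<open>Induction on a strict bound for the word lengths. Evaluating the expansion by last
  letters gives a left linear relation among the generators, so each \<open>rquot x p\<close>
  evaluates to zero and has shorter words.\<close>

lemma eval_words_inj:
  assumes "p \<in> free_algebra gens" "eval_words p = 0"
  shows "p = 0"
proof -
  have "p = 0" if "p \<in> free_algebra gens" "eval_words p = 0"
    "\<And>w. w \<in> Poly_Mapping.keys p \<Longrightarrow> length w < L" for L p
    using that
  proof (induction L arbitrary: p)
    case 0
    then have "Poly_Mapping.keys p = {}" by blast
    then show ?case by simp
  next
    case (Suc L)
    have keys: "w @ [x] \<in> Poly_Mapping.keys p" if "w \<in> Poly_Mapping.keys (rquot x p)" for w x
      using that by (simp add: in_keys_iff lookup_rquot)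
    have q: "rquot x p \<in> free_algebra gens" for x
      using keys Suc.prems(1) unfolding free_algebra_def by fastforce
    let ?c = "Poly_Mapping.lookup p []"
    have p: "p = smul ?c 1 + (\<Sum>x\<in>gens. rquot x p * Poly_Mapping.single [x] 1)"
      by (rule free_algebra_expand[OF Suc.prems(1) finite_gens])
    have one: "eval_words 1 = 1"
      using lin_ext_single[of prod_list "[]"] by (simp only: one_eq_single_Nil[where 'a = tens] prod_list.Nil)
    have "eval_words p = smul ?c 1 + (\<Sum>x\<in>gens. eval_words (rquot x p) * x)"
      by (subst p) (simp only: linD[OF lin_lin_ext] lin_sum[OF lin_lin_ext] eval_words_mult_letter one)
    then have sum: "smul ?c 1 + (\<Sum>i\<in>{2..m + 1}. \<Sum>x\<in>B i. eval_words (rquot x p) * x) = 0"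
      using Suc.prems(2) unfolding sum_gens by simp
    have Tens: "eval_words (rquot x p) \<in> Tens m" for x
      using eval_words_in_BV[OF q] BV_subset_Tens by blast
    have c: "?c = 0"
      by (rule B_left_independent(2)[OF _ sum]) (rule Tens)
    have "eval_words (rquot x p) = 0" if "x \<in> gens" for x
      using that B_left_independent(1)[where a = "\<lambda>i x. eval_words (rquot x p)", OF Tens sum] by blast
    then have "rquot x p = 0" if "x \<in> gens" for x
      using that keys Suc.prems(3) by (intro Suc.IH q) fastforce+
    then show ?case using p c by simp
  qed
  then show ?thesis
    using assms finite_nat_set_iff_bounded[of "length ` Poly_Mapping.keys p"] by auto
qed

text \<open>\<open>ker_span_B\<close> splits off a generator on the right, and the remaining kernel
  factor has smaller degree.\<close>

lemma ker_subset_eval_words: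
  assumes "1 \<le> m"
  shows "ker\<sigma> m n \<subseteq> eval_words ` free_algebra gens"
proof (induction n rule: less_induct)
  case (less n)
  have sub: "pm.subspace (eval_words ` free_algebra gens)"
    by (rule module_hom.subspace_image[OF lin_module_hom[OF lin_lin_ext] subspace_free_algebra])
  show ?case
  proof (cases "n = 0")
    case True
    have "Poly_Mapping.single [] (1::K) \<in> free_algebra gens" by (simp add: free_algebra_def)
    then have "1 \<in> eval_words ` free_algebra gens"
      by (rule rev_image_eqI) (simp add: lin_ext_single)
    then show ?thesis
      using True pm.subspace_scale[OF sub] by (auto simp: ker_0 Vpow_0)
  next
    case False
    have "{k * x |k x i. i \<in> {2..n} \<and> x \<in> B i \<and> k \<in> ker\<sigma> m (n - i)} \<subseteq> eval_words ` free_algebra gens"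
    proof clarify
      fix k x i assume *: "i \<in> {2..n}" "x \<in> B i" "k \<in> ker\<sigma> m (n - i)"
      then obtain q where q: "q \<in> free_algebra gens" "k = eval_words q"
        using less.IH[of "n - i"] by auto
      \<comment> \<open>The degree \<open>i\<close> may exceed \<open>m + 1\<close>, but then
        \<open>B i\<close> is empty.\<close>
      have "x \<in> gens" using * B_empty[OF _ assms, of i] by (cases "i \<le> m + 1") auto
      then have "q * Poly_Mapping.single [x] 1 \<in> free_algebra gens"
        using q(1) keys_mult[of q "Poly_Mapping.single [x] (1::K)"]
        by (fastforce simp: free_algebra_def plus_list_def)
      then show "k * x \<in> eval_words ` free_algebra gens"
        by (rule rev_image_eqI) (simp add: eval_words_mult_letter q(2))
    qed
    then show ?thesis
      using ker_span_B[of n] False pm.span_minimal[OF _ sub] by simp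
  qed
qed

lemma BV_freely_generated:
  assumes "1 \<le> m"
  shows "freely_generated (BV m) gens"
  unfolding freely_generated_def
proof (intro conjI subalgebra_BV gens_subset_BV)
  have "inj_on eval_words (free_algebra gens)"
  proof (rule inj_onI)
    fix p q assume "p \<in> free_algebra gens" "q \<in> free_algebra gens" "eval_words p = eval_words q"
    then have "p - q = 0"
      by (intro eval_words_inj pm.subspace_diff[OF subspace_free_algebra])
        (simp_all add: lin_minus[OF lin_lin_ext])
    then show "p = q" by simp
  qed
  moreover have "BV m \<subseteq> eval_words ` free_algebra gens"
  proof
    fix x assume "x \<in> BV m"
    moreover have "(\<Union>n. ker\<sigma> m n) \<subseteq> eval_words ` free_algebra gens"
      using ker_subset_eval_words[OF assms] by blast
    ultimately have "x \<in> pm.span (eval_words ` free_algebra gens)"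
      unfolding BV_def using pm.span_mono by blast
    also have "pm.span (eval_words ` free_algebra gens) = eval_words ` pm.span (free_algebra gens)"
      by (rule module_hom.span_image[OF lin_module_hom[OF lin_lin_ext]])
    also have "pm.span (free_algebra gens) = (free_algebra gens :: (tens list \<Rightarrow>\<^sub>0 K) set)"
      using subspace_free_algebra by simp
    finally show "x \<in> eval_words ` free_algebra gens" .
  qed
  ultimately show "bij_betw eval_words (free_algebra gens) (BV m)"
    using eval_words_in_BV by (auto simp: bij_betw_def)
qed

end

theorem theorem3p23:
  fixes m :: nat and W Bs :: "nat \<Rightarrow> tens set"
  assumes "m \<ge> 1"
    and "is_choice m W"
    and "\<And>i. i \<in> {2..m + 1} \<Longrightarrow> is_basis (Bs i) (W i)"
  shows "freely_generated (BV m) (\<Union>i\<in>{2..m + 1}. Bs i) \<and>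
    (1 - (\<Sum>i = 2..m + 1. monom (int (pm.dim (W i))) i) :: int poly)
      = [:1, - int m:] * [:1, 1:] ^ m"
proof -
  \<comment> \<open>Bases are given only up to degree \<open>m + 1\<close>; the locale asks for them
    in every degree from 2 on, so the higher ones are chosen here.\<close>
  have "\<exists>B. is_basis B (W n)" if "2 \<le> n" for n
  proof -
    have "pm.subspace (W n)" using assms(2) that by (simp add: is_choice_def)
    then show ?thesis
      using pm.basis_exists[of "W n"] pm.span_minimal unfolding is_basis_def by (metis subset_antisym)
  qed
  then obtain C where C: "\<And>n. 2 \<le> n \<Longrightarrow> is_basis (C n) (W n)" by metis
  let ?B = "\<lambda>n. if n \<le> m + 1 then Bs n else C n"
  interpret choice_bases m W ?B
    by unfold_locales (use assms C in auto)
  have "(\<Union>i\<in>{2..m + 1}. ?B i) = (\<Union>i\<in>{2..m + 1}. Bs i)" by simp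
  then show ?thesis using BV_freely_generated[OF assms(1)] generators_poly by simp
qed

end
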